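(* Let $\mathcal{A}$ be a $C^*$-algebra, let $X$ be a semi-inner product module over $\mathcal{A}$, let $a,b\in X$, and let $\overline{p}=(p_1,\dots,p_n)\in\mathbb{R}^n$ be a probability vector. If $\overline{x}=(x_1,\dots,x_n)\in X^n$, $\overline{y}=(y_1,\dots,y_n)\in X^n$, $r\ge 0$ and $s\geq 0$ are such that $$\|x_i-a\|\le r,\qquad \|y_i-b\|\le s\qquad\text{for all } i\in\{1,\dots,n\},$$ then $$\left\|\sum_{i=1}^n p_i\langle x_i,y_i\rangle-\left\langle\sum_{i=1}^n p_ix_i,\sum_{i=1}^n p_iy_i\right\rangle\right\|\le rs.$$ The constant $1$ as coefficient of $rs$ is best possible in the sense that it cannot be replaced by a smaller quantity: there is no constant $c<1$ such that the inequality with $rs$ replaced by $c\,rs$ holds for all $C^*$-algebras $\mathcal{A}$, all semi-inner product modules $X$ over $\mathcal{A}$, all positive integers $n$, all probability vectors $\overline{p}\in\mathbb{R}^n$, all $a,b\in X$, all $\overline{x}=(x_1,\dots,x_n),\overline{y}=(y_1,\dots,y_n)\in X^n$ and all $r,s\ge 0$ satisfying $\|x_i-a\|\le r$ and $\|y_i-b\|\le s$ for all $i\in\{1,\dots,n\}$.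
   Context: A semi-inner product module over a $C^*$-algebra $\mathcal{A}$ (a semi-inner product $C^*$-module) is a right $\mathcal{A}$-module $X$ (as usual, a complex vector space whose scalar multiplication is compatible with the $\mathcal{A}$-action) with a map $\langle\cdot,\cdot\rangle:X\times X\to\mathcal{A}$ such that (i) $\langle x,y+z\rangle=\langle x,y\rangle+\langle x,z\rangle$; (ii) $\langle x,ya\rangle=\langle x,y\rangle a$; (iii) $\langle x,y\rangle^*=\langle y,x\rangle$; (iv) $\langle x,x\rangle\ge 0$, for all $x,y,z\in X$, $a\in\mathcal{A}$. For $x\in X$, $\|x\|=\|\langle x,x\rangle\|^{1/2}$. A probability vector is $\overline{p}=(p_1,\dots,p_n)\in\mathbb{R}^n$ with $p_i\ge 0$ for all $i$ and $\sum_{i=1}^n p_i=1$. *)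

theory Defs
  imports Complex_Main "HOL-Algebra.Module"
begin

text \<open>
  Algebras and modules are carrier-based, on top of the records of HOL-Algebra, so that one
  formula can quantify over all of them. Complex vector spaces are modules over the ring of
  complex numbers. No unit is required of a C*-algebra: the inherited field \<open>one\<close> of
  \<open>cstar\<close> carries no assumption, and neither do the fields \<open>one\<close> and \<open>mult\<close> of \<open>ip_module\<close>.

  A formula of HOL cannot quantify over types. A claim that no constant serves all algebras and
  modules is therefore stated for those whose carriers are subsets of the type \<open>complex\<close>, with
  arbitrary operations; it implies the same claim for the class of all algebras and modules.
\<close>

definition complex_ring :: "complex ring" where
  "complex_ring = \<lparr>carrier = UNIV, mult = (*), one = 1, zero = 0, add = (+)\<rparr>"

record 'a cstar = "(complex, 'a) module" +
  star :: "'a \<Rightarrow> 'a"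
  cnorm :: "'a \<Rightarrow> real"

record ('a, 'x) ip_module = "(complex, 'x) module" +
  ract :: "'x \<Rightarrow> 'a \<Rightarrow> 'x"
  ip :: "'x \<Rightarrow> 'x \<Rightarrow> 'a"

locale cstar_algebra = Module.module complex_ring A
  for A :: "'a cstar" (structure) +
  assumes mult_closed:
      "\<lbrakk>u \<in> carrier A; v \<in> carrier A\<rbrakk> \<Longrightarrow> u \<otimes>\<^bsub>A\<^esub> v \<in> carrier A"
    and mult_assoc:
      "\<lbrakk>u \<in> carrier A; v \<in> carrier A; w \<in> carrier A\<rbrakk>
        \<Longrightarrow> (u \<otimes>\<^bsub>A\<^esub> v) \<otimes>\<^bsub>A\<^esub> w = u \<otimes>\<^bsub>A\<^esub> (v \<otimes>\<^bsub>A\<^esub> w)"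
    and mult_l_distr:
      "\<lbrakk>u \<in> carrier A; v \<in> carrier A; w \<in> carrier A\<rbrakk>
        \<Longrightarrow> (u \<oplus>\<^bsub>A\<^esub> v) \<otimes>\<^bsub>A\<^esub> w = u \<otimes>\<^bsub>A\<^esub> w \<oplus>\<^bsub>A\<^esub> v \<otimes>\<^bsub>A\<^esub> w"
    and mult_r_distr:
      "\<lbrakk>u \<in> carrier A; v \<in> carrier A; w \<in> carrier A\<rbrakk>
        \<Longrightarrow> u \<otimes>\<^bsub>A\<^esub> (v \<oplus>\<^bsub>A\<^esub> w) = u \<otimes>\<^bsub>A\<^esub> v \<oplus>\<^bsub>A\<^esub> u \<otimes>\<^bsub>A\<^esub> w"
    and mult_smult_l:
      "\<lbrakk>u \<in> carrier A; v \<in> carrier A\<rbrakk>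
        \<Longrightarrow> (k \<odot>\<^bsub>A\<^esub> u) \<otimes>\<^bsub>A\<^esub> v = k \<odot>\<^bsub>A\<^esub> (u \<otimes>\<^bsub>A\<^esub> v)"
    and mult_smult_r:
      "\<lbrakk>u \<in> carrier A; v \<in> carrier A\<rbrakk>
        \<Longrightarrow> u \<otimes>\<^bsub>A\<^esub> (k \<odot>\<^bsub>A\<^esub> v) = k \<odot>\<^bsub>A\<^esub> (u \<otimes>\<^bsub>A\<^esub> v)"
    and star_closed:
      "u \<in> carrier A \<Longrightarrow> star A u \<in> carrier A"
    and star_star:
      "u \<in> carrier A \<Longrightarrow> star A (star A u) = u"
    and star_add:
      "\<lbrakk>u \<in> carrier A; v \<in> carrier A\<rbrakk>
        \<Longrightarrow> star A (u \<oplus>\<^bsub>A\<^esub> v) = star A u \<oplus>\<^bsub>A\<^esub> star A v"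
    and star_smult:
      "u \<in> carrier A \<Longrightarrow> star A (k \<odot>\<^bsub>A\<^esub> u) = cnj k \<odot>\<^bsub>A\<^esub> star A u"
    and star_mult:
      "\<lbrakk>u \<in> carrier A; v \<in> carrier A\<rbrakk>
        \<Longrightarrow> star A (u \<otimes>\<^bsub>A\<^esub> v) = star A v \<otimes>\<^bsub>A\<^esub> star A u"
    and cnorm_nonneg:
      "u \<in> carrier A \<Longrightarrow> 0 \<le> cnorm A u"
    and cnorm_eq_0:
      "u \<in> carrier A \<Longrightarrow> cnorm A u = 0 \<longleftrightarrow> u = \<zero>\<^bsub>A\<^esub>"
    and cnorm_add:
      "\<lbrakk>u \<in> carrier A; v \<in> carrier A\<rbrakk>
        \<Longrightarrow> cnorm A (u \<oplus>\<^bsub>A\<^esub> v) \<le> cnorm A u + cnorm A v"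
    and cnorm_smult:
      "u \<in> carrier A \<Longrightarrow> cnorm A (k \<odot>\<^bsub>A\<^esub> u) = cmod k * cnorm A u"
    and cnorm_mult:
      "\<lbrakk>u \<in> carrier A; v \<in> carrier A\<rbrakk>
        \<Longrightarrow> cnorm A (u \<otimes>\<^bsub>A\<^esub> v) \<le> cnorm A u * cnorm A v"
    and cstar_identity:
      "u \<in> carrier A \<Longrightarrow> cnorm A (star A u \<otimes>\<^bsub>A\<^esub> u) = (cnorm A u)\<^sup>2"
    and complete:
      "\<lbrakk>range f \<subseteq> carrier A;
        \<forall>\<epsilon>>0. \<exists>N. \<forall>i\<ge>N. \<forall>j\<ge>N. cnorm A (f i \<ominus>\<^bsub>A\<^esub> f j) < \<epsilon>\<rbrakk>
        \<Longrightarrow> \<exists>l\<in>carrier A. (\<lambda>i. cnorm A (f i \<ominus>\<^bsub>A\<^esub> l)) \<longlonglongrightarrow> 0"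

text \<open>
  Positivity as \<open>u = v* v\<close>, which makes sense without a unit.
\<close>

definition cstar_pos :: "'a cstar \<Rightarrow> 'a \<Rightarrow> bool" where
  "cstar_pos A u \<longleftrightarrow> (\<exists>v\<in>carrier A. u = star A v \<otimes>\<^bsub>A\<^esub> v)"

locale semi_inner_product_module =
  A: cstar_algebra A + X: Module.module complex_ring X
  for A :: "'a cstar" (structure) and X :: "('a, 'x) ip_module" (structure) +
  assumes ract_closed:
      "\<lbrakk>x \<in> carrier X; u \<in> carrier A\<rbrakk> \<Longrightarrow> ract X x u \<in> carrier X"
    and ract_add_l:
      "\<lbrakk>x \<in> carrier X; y \<in> carrier X; u \<in> carrier A\<rbrakk>
        \<Longrightarrow> ract X (x \<oplus>\<^bsub>X\<^esub> y) u = ract X x u \<oplus>\<^bsub>X\<^esub> ract X y u"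
    and ract_add_r:
      "\<lbrakk>x \<in> carrier X; u \<in> carrier A; v \<in> carrier A\<rbrakk>
        \<Longrightarrow> ract X x (u \<oplus>\<^bsub>A\<^esub> v) = ract X x u \<oplus>\<^bsub>X\<^esub> ract X x v"
    and ract_mult:
      "\<lbrakk>x \<in> carrier X; u \<in> carrier A; v \<in> carrier A\<rbrakk>
        \<Longrightarrow> ract X x (u \<otimes>\<^bsub>A\<^esub> v) = ract X (ract X x u) v"
    and ract_smult_l:
      "\<lbrakk>x \<in> carrier X; u \<in> carrier A\<rbrakk>
        \<Longrightarrow> ract X (k \<odot>\<^bsub>X\<^esub> x) u = k \<odot>\<^bsub>X\<^esub> ract X x u"
    and ract_smult_r:
      "\<lbrakk>x \<in> carrier X; u \<in> carrier A\<rbrakk>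
        \<Longrightarrow> ract X x (k \<odot>\<^bsub>A\<^esub> u) = k \<odot>\<^bsub>X\<^esub> ract X x u"
    and ip_closed:
      "\<lbrakk>x \<in> carrier X; y \<in> carrier X\<rbrakk> \<Longrightarrow> ip X x y \<in> carrier A"
    and ip_add:
      "\<lbrakk>x \<in> carrier X; y \<in> carrier X; z \<in> carrier X\<rbrakk>
        \<Longrightarrow> ip X x (y \<oplus>\<^bsub>X\<^esub> z) = ip X x y \<oplus>\<^bsub>A\<^esub> ip X x z"
    and ip_ract:
      "\<lbrakk>x \<in> carrier X; y \<in> carrier X; u \<in> carrier A\<rbrakk>
        \<Longrightarrow> ip X x (ract X y u) = ip X x y \<otimes>\<^bsub>A\<^esub> u"
    and ip_star:
      "\<lbrakk>x \<in> carrier X; y \<in> carrier X\<rbrakk> \<Longrightarrow> star A (ip X x y) = ip X y x"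
    and ip_pos:
      "x \<in> carrier X \<Longrightarrow> cstar_pos A (ip X x x)"

definition xnorm :: "'a cstar \<Rightarrow> ('a, 'x) ip_module \<Rightarrow> 'x \<Rightarrow> real" where
  "xnorm A X x = sqrt (cnorm A (ip X x x))"

definition probability_vector :: "nat \<Rightarrow> (nat \<Rightarrow> real) \<Rightarrow> bool" where
  "probability_vector n p \<longleftrightarrow> (\<forall>i\<in>{1..n}. 0 \<le> p i) \<and> (\<Sum>i=1..n. p i) = 1"

end

theory Submission
  imports Defs "HOL-Analysis.Operator_Norm"
begin

text \<open>
  Write \<open>C(x, y)\<close> for the weighted covariance \<open>\<Sum>p\<^sub>i \<langle>x\<^sub>i, y\<^sub>i\<rangle> - \<langle>\<Sum>p\<^sub>i x\<^sub>i, \<Sum>p\<^sub>i y\<^sub>i\<rangle>\<close>. It does not change when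
  \<open>x\<close> and \<open>y\<close> are translated, and centring at the means exhibits it as
  \<open>\<Sum>p\<^sub>i \<langle>x\<^sub>i - x\<^sub>m, y\<^sub>i - y\<^sub>m\<rangle>\<close>, where \<open>x\<^sub>m\<close> and \<open>y\<^sub>m\<close> are the weighted means; so it is an algebra-valued
  semi-inner product on families of vectors. The Cauchy-Schwarz inequality bounds the norm of \<open>C(x, y)\<close>
  by the square roots of the norms of \<open>C(x, x)\<close> and \<open>C(y, y)\<close>. Centring at \<open>a\<close> instead gives
  \<open>C(x, x) \<le> \<Sum>p\<^sub>i \<langle>x\<^sub>i - a, x\<^sub>i - a\<rangle>\<close>, of norm at most \<open>r\<^sup>2\<close>, and likewise for \<open>y\<close>. The covariance of the
  numbers \<open>1\<close> and \<open>-1\<close> with equal weights shows that the constant is sharp.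
  
  These arguments live in the order of a C*-algebra: sums of elements \<open>v\<^sup>* v\<close> must be positive, and
  \<open>0 \<le> u \<le> t\<close> must bound the norm of \<open>u\<close> by \<open>t\<close>. The order is developed here without spectra or functional
  calculus. Positivity of a selfadjoint \<open>w\<close> is expressed by \<open>\<parallel>t - w\<parallel> \<le> t\<close>, which makes the cone property
  clear; a convergent iteration provides square roots (\<open>sqrt_near_one\<close>), and pairing commuting
  selfadjoint elements into \<open>h + i k\<close> gives the norm estimates. The main point is
  \<open>positive_adj_mult_self\<close>, that \<open>v\<^sup>* v\<close> is positive; \<open>norm_mixed_term_le\<close> is the Cauchy-Schwarz step.
  
  Since the algebra need not have a unit, a unit is adjoined (type \<open>unitization\<close>). The analysis takes
  place in type classes, where sums, limits and completeness are at hand, and yields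
  \<open>norm_covariance_le\<close>. It reaches algebras and modules on carrier sets through types that are cut
  out of a single pair of carriers, chosen so that it violates the bound if any pair does
  (\<open>critical_pair\<close>).
\<close>

section \<open>Positive elements of a unital C*-algebra\<close>

text \<open>
  The axioms shared by an algebra and its unitization. Half of the C*-identity is stated, the half that
  does not follow from submultiplicativity.
\<close>
class real_cstar_algebra = real_normed_algebra + banach +
  fixes adj :: "'a \<Rightarrow> 'a"
  assumes adj_adj [simp]: "adj (adj u) = u"
    and adj_add [simp]: "adj (u + v) = adj u + adj v"
    and adj_mult [simp]: "adj (u * v) = adj v * adj u"
    and adj_scaleR [simp]: "adj (t *\<^sub>R u) = t *\<^sub>R adj u"
    and norm_square_le: "(norm u)\<^sup>2 \<le> norm (adj u * u)"

lemma adj_zero [simp]: "adj (0::'a::real_cstar_algebra) = 0"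
  using adj_scaleR[of 0 0] by simp

lemma adj_minus [simp]: "adj (- (u::'a::real_cstar_algebra)) = - adj u"
  using adj_scaleR[of "-1" u] by simp

lemma adj_diff [simp]: "adj (u - (v::'a::real_cstar_algebra)) = adj u - adj v"
  using adj_add[of u "- v"] by simp

lemma adj_sum: "adj (sum f I) = (\<Sum>i\<in>I. adj (f i :: 'a::real_cstar_algebra))"
  by (induction I rule: infinite_finite_induct) auto

lemma norm_adj [simp]: "norm (adj (u::'a::real_cstar_algebra)) = norm u"
proof -
  have le: "norm u \<le> norm (adj u)" for u :: 'a
  proof (cases "u = 0")
    case False
    have "norm u * norm u \<le> norm (adj u) * norm u"
      using norm_square_le[of u] norm_mult_ineq[of "adj u" u] by (simp add: power2_eq_square)
    with False show ?thesis by simp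
  qed simp
  show ?thesis using le[of u] le[of "adj u"] by simp
qed

lemma norm_adj_mult_self: "norm (adj u * (u::'a::real_cstar_algebra)) = (norm u)\<^sup>2"
  using norm_square_le[of u] norm_mult_ineq[of "adj u" u] by (simp add: power2_eq_square)

lemma adj_mult_self_eq_0: "adj u * u = 0 \<longleftrightarrow> (u::'a::real_cstar_algebra) = 0"
  using norm_adj_mult_self[of u] norm_eq_zero[of u] by auto

lemma selfadjoint_square_eq_0: "adj u = u \<Longrightarrow> u * u = 0 \<Longrightarrow> (u::'a::real_cstar_algebra) = 0"
  using adj_mult_self_eq_0[of u] by simp

lemma bounded_linear_adj: "bounded_linear (adj :: 'a::real_cstar_algebra \<Rightarrow> 'a)"
  by (rule bounded_linear_intro[where K = 1]) auto

class unital_cstar_algebra = real_cstar_algebra + real_normed_algebra_1 +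
  fixes imag_unit :: 'a
  assumes imag_unit_commute: "imag_unit * u = u * imag_unit"
    and imag_unit_square [simp]: "imag_unit * imag_unit = - 1"
    and adj_imag_unit [simp]: "adj imag_unit = - imag_unit"

lemma adj_one [simp]: "adj (1 :: 'a::unital_cstar_algebra) = 1"
  by (metis adj_adj adj_mult mult_1_right mult_1_left)

text \<open>
  For a selfadjoint \<open>w\<close> the inequality says that the spectrum lies in \<open>[0, 2 t]\<close>. This form needs no
  spectral theory, and sums of positive elements are positive by the triangle inequality.
\<close>
definition positive :: "'a::unital_cstar_algebra \<Rightarrow> bool" where
  "positive w \<longleftrightarrow> adj w = w \<and> (\<exists>t. norm (t *\<^sub>R 1 - w) \<le> t)"

lemma positive_adj: "positive w \<Longrightarrow> adj w = w"
  by (simp add: positive_def)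

lemma positive_zero [simp]: "positive 0"
  by (auto simp: positive_def intro: exI[of _ 0])

lemma positive_add: "positive v \<Longrightarrow> positive w \<Longrightarrow> positive (v + w)"
proof -
  assume "positive v" "positive w"
  then obtain s t where v: "adj v = v" "norm (s *\<^sub>R 1 - v) \<le> s"
    and w: "adj w = w" "norm (t *\<^sub>R 1 - w) \<le> t"
    by (auto simp: positive_def)
  have "norm ((s + t) *\<^sub>R 1 - (v + w)) = norm ((s *\<^sub>R 1 - v) + (t *\<^sub>R 1 - w))"
    by (simp add: algebra_simps)
  also have "\<dots> \<le> s + t"
    using norm_triangle_ineq[of "s *\<^sub>R 1 - v" "t *\<^sub>R 1 - w"] v w by linarith
  finally show ?thesis using v w by (auto simp: positive_def)
qed

lemma positive_scaleR: "0 \<le> k \<Longrightarrow> positive w \<Longrightarrow> positive (k *\<^sub>R w)"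
proof -
  assume k: "0 \<le> k" and "positive w"
  then obtain t where w: "adj w = w" "norm (t *\<^sub>R 1 - w) \<le> t"
    by (auto simp: positive_def)
  have "norm ((k * t) *\<^sub>R 1 - k *\<^sub>R w) = norm (k *\<^sub>R (t *\<^sub>R 1 - w))"
    by (simp add: scaleR_diff_right)
  also have "\<dots> \<le> k * t" using k w by (simp add: mult_left_mono)
  finally show ?thesis using w by (auto simp: positive_def)
qed

lemma positive_sum: "(\<And>i. i \<in> I \<Longrightarrow> positive (f i)) \<Longrightarrow> positive (sum f I)"
  by (induction I rule: infinite_finite_induct) (auto intro: positive_add)

lemma positive_bound_minus:
  "adj g = g \<Longrightarrow> norm g \<le> t \<Longrightarrow> positive (t *\<^sub>R 1 - g)"
  by (auto simp: positive_def intro!: exI[of _ t])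

text \<open>
  A square root of \<open>w = 1 - x\<close> is \<open>1 - L\<close>, where \<open>L\<close> solves \<open>2 L = x + L\<^sup>2\<close>. Iterating this equation
  from \<open>0\<close> gives polynomials \<open>Y n\<close> in \<open>x\<close> with nonnegative coefficients, so their increments are bounded
  by those of the same iteration at the number \<open>1\<close>. That scalar sequence increases and is bounded, and
  so the iteration converges even when the norm of \<open>x\<close> is exactly \<open>1\<close>, where the contraction principle
  gives nothing. As a limit of polynomials in \<open>w\<close>, the root commutes with all that commutes with \<open>w\<close>.
\<close>
lemma sqrt_near_one:
  fixes w :: "'a::unital_cstar_algebra"
  assumes w: "adj w = w" "norm (1 - w) \<le> 1"
  obtains s where "adj s = s" "norm (1 - s) \<le> 1" "s * s = w"
    "\<And>z. z * w = w * z \<Longrightarrow> z * s = s * z"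
proof -
  define x where "x = 1 - w"
  define Y where "Y = rec_nat (0::'a) (\<lambda>_ y. (1/2) *\<^sub>R (x + y * y))"
  define y where "y = rec_nat (0::real) (\<lambda>_ y. (1 + y * y) / 2)"
  have Y0: "Y 0 = 0" and YS: "Y (Suc n) = (1/2) *\<^sub>R (x + Y n * Y n)" for n
    by (simp_all add: Y_def)
  have y0: "y 0 = 0" and yS: "y (Suc n) = (1 + y n * y n) / 2" for n
    by (simp_all add: y_def)
  have comm: "z * Y n = Y n * z" if "z * w = w * z" for z n
  proof (induction n)
    case (Suc n)
    have "z * x = x * z" using that by (simp add: x_def algebra_simps)
    moreover have "z * (Y n * Y n) = (Y n * Y n) * z"
      using Suc by (metis mult.assoc)
    ultimately show ?case by (simp add: YS algebra_simps)
  qed (simp add: Y0)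
  have Yw: "Y n * w = w * Y n" for n using comm[of w n] by simp
  have YY: "Y m * Y n = Y n * Y m" for m n by (rule comm[OF Yw])
  have sa: "adj (Y n) = Y n" for n
    by (induction n) (auto simp: Y0 YS x_def w)
  have y_bd: "0 \<le> y n \<and> y n \<le> 1" for n
  proof (induction n)
    case (Suc n)
    then have "y n * y n \<le> 1 * 1" by (intro mult_mono) auto
    with Suc show ?case by (simp add: yS)
  qed (simp add: y0)
  have Y_bd: "norm (Y n) \<le> y n" for n
  proof (induction n)
    case (Suc n)
    have "norm (Y n * Y n) \<le> y n * y n"
      by (rule order_trans[OF norm_mult_ineq]) (use Suc y_bd in \<open>auto intro: mult_mono\<close>)
    then have "norm (x + Y n * Y n) \<le> 1 + y n * y n"
      using norm_triangle_ineq[of x "Y n * Y n"] w by (simp add: x_def)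
    then show ?case by (simp add: YS yS)
  qed (simp add: Y0 y0)
  \<comment> \<open>Differences of squares factor, as the \<open>Y n\<close> commute; so increments are dominated
    inductively by those of \<open>y\<close>.\<close>
  have step: "norm (Y (Suc n) - Y n) \<le> y (Suc n) - y n" for n
  proof (induction n)
    case 0
    then show ?case using w by (simp add: Y0 YS y0 yS x_def)
  next
    case (Suc n)
    have "Y (Suc (Suc n)) - Y (Suc n) = (1/2) *\<^sub>R (Y (Suc n) * Y (Suc n) - Y n * Y n)"
      by (simp add: YS[of "Suc n"] YS[of n] scaleR_right_diff_distrib[symmetric])
    also have "\<dots> = (1/2) *\<^sub>R ((Y (Suc n) - Y n) * (Y (Suc n) + Y n))"
      using YY[of "Suc n" n] by (simp add: algebra_simps)
    finally have "norm (Y (Suc (Suc n)) - Y (Suc n))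
        = norm ((Y (Suc n) - Y n) * (Y (Suc n) + Y n)) / 2" by simp
    also have "\<dots> \<le> ((y (Suc n) - y n) * (y (Suc n) + y n)) / 2"
    proof (rule divide_right_mono)
      have "norm (Y (Suc n) + Y n) \<le> y (Suc n) + y n"
        using norm_triangle_ineq[of "Y (Suc n)" "Y n"] Y_bd[of n] Y_bd[of "Suc n"] by linarith
      then show "norm ((Y (Suc n) - Y n) * (Y (Suc n) + Y n)) \<le> (y (Suc n) - y n) * (y (Suc n) + y n)"
        using Suc order_trans[OF norm_ge_zero Suc]
        by (intro order_trans[OF norm_mult_ineq] mult_mono) auto
    qed simp
    also have "\<dots> = y (Suc (Suc n)) - y (Suc n)"
      unfolding yS[of "Suc n"] yS[of n] by (simp add: field_simps)
    finally show ?case .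
  qed
  have inc: "incseq y"
    using step order_trans[OF norm_ge_zero] by (intro incseq_SucI) fastforce
  have tele: "norm (Y (m + k) - Y m) \<le> y (m + k) - y m" for m k
  proof (induction k)
    case (Suc k)
    have "norm (Y (m + Suc k) - Y m) \<le> norm (Y (Suc (m + k)) - Y (m + k)) + norm (Y (m + k) - Y m)"
      using norm_triangle_ineq[of "Y (Suc (m + k)) - Y (m + k)" "Y (m + k) - Y m"] by simp
    then show ?case using step[of "m + k"] Suc by simp
  qed simp
  have "Cauchy y"
    using inc y_bd by (intro convergent_Cauchy Bseq_mono_convergent BseqI'[of y 1])
      (auto simp: incseq_def)
  have "Cauchy Y"
  proof (rule CauchyI')
    fix e :: real assume "0 < e"
    with \<open>Cauchy y\<close> obtain M where M: "norm (y m - y n) < e" if "M \<le> m" "M \<le> n" for m n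
      by (metis CauchyD)
    show "\<exists>M. \<forall>m\<ge>M. \<forall>n>m. dist (Y m) (Y n) < e"
    proof (intro exI allI impI)
      fix m n assume "M \<le> m" "m < n"
      then have "norm (Y n - Y m) \<le> y n - y m" using tele[of m "n - m"] by simp
      also have "\<dots> < e" using M[of n m] \<open>M \<le> m\<close> \<open>m < n\<close> by auto
      finally show "dist (Y m) (Y n) < e" by (simp add: dist_norm norm_minus_commute)
    qed
  qed
  then obtain L where L: "Y \<longlonglongrightarrow> L" using Cauchy_convergent convergent_def by blast
  have "(\<lambda>n. Y (Suc n)) \<longlonglongrightarrow> (1/2) *\<^sub>R (x + L * L)"
    unfolding YS by (intro tendsto_intros L)
  then have LL: "L = (1/2) *\<^sub>R (x + L * L)"
    using LIMSEQ_Suc[OF L] LIMSEQ_unique by blast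
  then have "2 *\<^sub>R L = x + L * L" by (metis scaleR_half_double scaleR_2 scaleR_right.add)
  then have sq: "(1 - L) * (1 - L) = w" by (simp add: algebra_simps x_def scaleR_2)
  have "adj L = L"
    using bounded_linear.tendsto[OF bounded_linear_adj L] L LIMSEQ_unique by (simp add: sa)
  moreover have "norm L \<le> 1"
    using L Y_bd y_bd by (intro LIMSEQ_le_const2[OF tendsto_norm[OF L]]) (meson order_trans)
  moreover have "z * L = L * z" if "z * w = w * z" for z
  proof -
    have "(\<lambda>n. z * Y n) \<longlonglongrightarrow> z * L" "(\<lambda>n. Y n * z) \<longlonglongrightarrow> L * z" by (intro tendsto_intros L)+
    then show ?thesis using comm[OF that] LIMSEQ_unique by auto
  qed
  ultimately show thesis
    by (intro that[of "1 - L"] sq) (simp_all add: right_diff_distrib left_diff_distrib)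
qed

lemma positive_sqrt:
  fixes w :: "'a::unital_cstar_algebra"
  assumes "positive w"
  obtains s where "positive s" "s * s = w" "\<And>z. z * w = w * z \<Longrightarrow> z * s = s * z"
proof -
  obtain t where w: "adj w = w" and t: "norm (t *\<^sub>R 1 - w) \<le> t"
    using assms by (auto simp: positive_def)
  have "0 \<le> t" using t norm_ge_zero order_trans by blast
  show thesis
  proof (cases "t = 0")
    case True
    with t show thesis by (intro that[of 0]) auto
  next
    case False
    with \<open>0 \<le> t\<close> have "0 < t" by simp
    have scale: "1 - (1/t) *\<^sub>R w = (1/t) *\<^sub>R (t *\<^sub>R 1 - w)"
      using False by (simp add: scaleR_diff_right)
    have wt: "adj ((1/t) *\<^sub>R w) = (1/t) *\<^sub>R w" using w by simp
    have nt: "norm (1 - (1/t) *\<^sub>R w) \<le> 1" unfolding scale using t \<open>0 < t\<close> by simp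
    obtain s where s: "adj s = s" "norm (1 - s) \<le> 1" "s * s = (1/t) *\<^sub>R w"
      and comm: "\<And>z. z * ((1/t) *\<^sub>R w) = (1/t) *\<^sub>R w * z \<Longrightarrow> z * s = s * z"
      using sqrt_near_one[OF wt nt] by metis
    show thesis
    proof (rule that[of "sqrt t *\<^sub>R s"])
      have "positive s" using s by (auto simp: positive_def intro!: exI[of _ 1])
      then show "positive (sqrt t *\<^sub>R s)" using \<open>0 \<le> t\<close> by (intro positive_scaleR) auto
      show "sqrt t *\<^sub>R s * sqrt t *\<^sub>R s = w"
        using s \<open>0 < t\<close> by simp
      show "z * sqrt t *\<^sub>R s = sqrt t *\<^sub>R s * z" if "z * w = w * z" for z
        using comm[of z] that by simp
    qed
  qed
qed

text \<open>
  The square sum is the modulus squared of the normal element \<open>h + i k\<close>. Here the complex scalars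
  enter: information on the norm of \<open>h\<^sup>2 + k\<^sup>2\<close> passes to \<open>h + i k\<close> by the C*-identity, and from there
  to \<open>h\<close> and \<open>k\<close>.
\<close>
lemma adj_mult_self_commuting:
  fixes h k :: "'a::unital_cstar_algebra"
  assumes "adj h = h" "adj k = k" "h * k = k * h"
  shows "adj (h + imag_unit * k) * (h + imag_unit * k) = h * h + k * k"
proof -
  have 1: "k * imag_unit * h = h * imag_unit * k"
    by (metis assms(3) imag_unit_commute mult.assoc)
  have 2: "k * imag_unit * (imag_unit * k) = - (k * k)"
    by (metis imag_unit_square mult.assoc mult_minus1 mult_minus_right)
  show ?thesis using assms 1 2 by (simp add: algebra_simps)
qed

lemma norm_le_1_of_square_sum:
  fixes h k :: "'a::unital_cstar_algebra"
  assumes sa: "adj h = h" "adj k = k" and comm: "h * k = k * h" and one: "h * h + k * k = 1"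
  shows "norm h \<le> 1"
proof -
  define u where "u = h + imag_unit * k"
  have "adj u * u = 1" using adj_mult_self_commuting[OF sa comm] one by (simp add: u_def)
  then have "norm u ^ 2 = 1" using norm_adj_mult_self[of u] by simp
  then have nu: "norm u = 1" using power2_eq_1_iff[of "norm u"] norm_ge_zero[of u] by linarith
  have "u + adj u = 2 *\<^sub>R h"
    using sa imag_unit_commute[of k] by (simp add: u_def scaleR_2)
  then have "norm (2 *\<^sub>R h) \<le> 2"
    using norm_triangle_ineq[of u "adj u"] nu by simp
  then show ?thesis by simp
qed

text \<open>
  After scaling, \<open>1 - h\<^sup>2\<close> has a square root \<open>k\<close>, and \<open>h + i k\<close> is unitary. Hence \<open>k\<close> is a contraction, and
  so is \<open>k\<^sup>2 = 1 - h\<^sup>2\<close>, which is what positivity of \<open>h\<^sup>2\<close> means.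
\<close>
lemma positive_square:
  fixes h :: "'a::unital_cstar_algebra"
  assumes "adj h = h"
  shows "positive (h * h)"
proof (cases "h = 0")
  case False
  define g where "g = (1 / norm h) *\<^sub>R h"
  have g: "adj g = g" "norm g = 1" using assms False by (auto simp: g_def)
  have gg: "adj (1 - g * g) = 1 - g * g" using g by simp
  have "norm (1 - (1 - g * g)) \<le> 1"
    using norm_mult_ineq[of g g] g by simp
  then obtain k where k: "adj k = k" "k * k = 1 - g * g"
    and comm: "\<And>z. z * (1 - g * g) = (1 - g * g) * z \<Longrightarrow> z * k = k * z"
    using sqrt_near_one[OF gg] by metis
  have "g * k = k * g" by (intro comm) (simp add: algebra_simps)
  then have "norm k \<le> 1" using k g by (intro norm_le_1_of_square_sum[of k g]) auto
  then have "norm (k * k) \<le> 1"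
    using norm_mult_ineq[of k k] mult_mono[of "norm k" 1 "norm k" 1] by simp
  then have "positive (g * g)" using g k by (auto simp: positive_def intro!: exI[of _ 1])
  then have "positive ((norm h)\<^sup>2 *\<^sub>R (g * g))" by (intro positive_scaleR) auto
  then show ?thesis using False by (simp add: g_def power2_eq_square)
qed simp

text \<open>
  If \<open>w = c\<^sup>2\<close> and \<open>- w = d\<^sup>2\<close> with commuting roots, then \<open>c + i d\<close> has modulus zero.
\<close>
lemma positive_antisym:
  fixes w :: "'a::unital_cstar_algebra"
  assumes "positive w" "positive (- w)"
  shows "w = 0"
proof -
  obtain c where c: "positive c" "c * c = w" and cc: "\<And>z. z * w = w * z \<Longrightarrow> z * c = c * z"
    using positive_sqrt[OF assms(1)] by metis
  obtain d where d: "positive d" "d * d = - w" and dc: "\<And>z. z * (- w) = (- w) * z \<Longrightarrow> z * d = d * z"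
    using positive_sqrt[OF assms(2)] by metis
  have "c * d = d * c" by (intro dc) (metis c(2) mult.assoc mult_minus_left mult_minus_right)
  then have "adj (c + imag_unit * d) * (c + imag_unit * d) = 0"
    using adj_mult_self_commuting[of c d] c d by (simp add: positive_adj)
  then have z: "c + imag_unit * d = 0" by (simp only: adj_mult_self_eq_0)
  then have "adj (c + imag_unit * d) = 0" by simp
  then have "c - imag_unit * d = 0"
    using c d imag_unit_commute[of d] by (simp add: positive_adj)
  with z have "2 *\<^sub>R c = 0" by (simp add: scaleR_2)
  then show ?thesis using c by simp
qed

text \<open>
  The sum is half of \<open>p\<^sup>2 + q\<^sup>2\<close>, where \<open>p / 2\<close> is the real part of \<open>v\<close> and \<open>- q / 2\<close> its imaginary part.
\<close>
lemma positive_adj_mult_self_add: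
  fixes v :: "'a::unital_cstar_algebra"
  shows "positive (v * adj v + adj v * v)"
proof -
  define p where "p = v + adj v"
  define q where "q = imag_unit * (v - adj v)"
  have "adj q = q"
    using imag_unit_commute[of "v - adj v"] by (simp add: q_def algebra_simps)
  moreover have "adj p = p" by (simp add: p_def add.commute)
  ultimately have "positive (p * p + q * q)" by (intro positive_add positive_square)
  moreover have "q * q = - ((v - adj v) * (v - adj v))"
  proof -
    have "q * q = imag_unit * imag_unit * ((v - adj v) * (v - adj v))"
      unfolding q_def using imag_unit_commute[of "v - adj v"] by (metis mult.assoc)
    then show ?thesis by simp
  qed
  ultimately have "positive ((1/2) *\<^sub>R (p * p - (v - adj v) * (v - adj v)))"
    by (intro positive_scaleR) auto
  moreover have "p * p - (v - adj v) * (v - adj v) = 2 *\<^sub>R (v * adj v + adj v * v)"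
    by (simp add: p_def algebra_simps scaleR_2)
  ultimately show ?thesis by simp
qed

text \<open>
  If \<open>v\<^sup>* v = - Q\<close> with \<open>Q\<close> positive, then \<open>P = v v\<^sup>*\<close> is positive, because the sum \<open>v v\<^sup>* + v\<^sup>* v\<close> is. The usual
  contradiction compares the spectra of \<open>v v\<^sup>*\<close> and \<open>v\<^sup>* v\<close>. Instead, the element \<open>t = \<surd>Q v\<^sup>*\<close> satisfies
  \<open>t\<^sup>* t = - P\<^sup>2\<close> and \<open>t t\<^sup>* = - Q\<^sup>2\<close>: both are negative and their sum is positive, so that \<open>Q = 0\<close>.
\<close>
lemma eq_0_of_negative_adj_mult_self:
  fixes v :: "'a::unital_cstar_algebra"
  assumes "positive (- (adj v * v))"
  shows "v = 0"
proof -
  define P where "P = v * adj v"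
  define Q where "Q = - (adj v * v)"
  have "positive (v * adj v + adj v * v + Q)"
    using assms by (intro positive_add positive_adj_mult_self_add) (simp add: Q_def)
  then have P: "positive P" by (simp add: P_def Q_def)
  have Q: "positive Q" using assms by (simp add: Q_def)
  obtain e where e: "positive e" "e * e = Q" and ec: "\<And>z. z * Q = Q * z \<Longrightarrow> z * e = e * z"
    using positive_sqrt[OF Q] by metis
  define t where "t = e * adj v"
  have "adj t * t = v * (e * e) * adj v"
    using positive_adj[OF e(1)] by (simp add: t_def mult.assoc)
  then have 1: "adj t * t = - (P * P)" by (simp add: e(2) P_def Q_def mult.assoc)
  have "t * adj t = e * (adj v * v) * e" using e by (simp add: t_def positive_adj mult.assoc)
  also have "\<dots> = - (e * (e * e) * e)" by (simp add: e Q_def)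
  also have "\<dots> = - (Q * Q)" by (metis e(2) mult.assoc)
  finally have 2: "t * adj t = - (Q * Q)" .
  have "positive (t * adj t + adj t * t + P * P)"
    using P by (intro positive_add positive_adj_mult_self_add positive_square) (simp add: positive_adj)
  then have "positive (- (Q * Q))" by (simp add: 1 2)
  then have "Q * Q = 0"
    using Q by (intro positive_antisym positive_square) (auto simp: positive_adj)
  then have "Q = 0" using Q selfadjoint_square_eq_0 positive_adj by blast
  then show ?thesis by (simp add: Q_def adj_mult_self_eq_0)
qed

text \<open>
  The theorem of Fukamiya and Kaplansky. Let \<open>h = v\<^sup>* v\<close> and \<open>a = |h|\<close>. Then \<open>w = a - h\<close> is twice the
  negative part of \<open>h\<close>, and \<open>v w\<close> satisfies the hypothesis of the preceding lemma, since \<open>w h w = - a w\<^sup>2\<close>.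
  So \<open>v w = 0\<close>, which forces \<open>w = 0\<close> and \<open>h = |h|\<close>.
\<close>
theorem positive_adj_mult_self:
  fixes v :: "'a::unital_cstar_algebra"
  shows "positive (adj v * v)"
proof -
  define h where "h = adj v * v"
  have sa: "adj h = h" by (simp add: h_def)
  obtain a where a: "positive a" "a * a = h * h"
    and ac: "\<And>z. z * (h * h) = h * h * z \<Longrightarrow> z * a = a * z"
    using positive_sqrt[OF positive_square[OF sa]] by metis
  have ha: "h * a = a * h" by (rule ac) (simp add: mult.assoc)
  obtain c where c: "positive c" "c * c = a" and cc: "\<And>z. z * a = a * z \<Longrightarrow> z * c = c * z"
    using positive_sqrt[OF a(1)] by metis
  define w where "w = a - h"
  have wsa: "adj w = w" using a sa by (simp add: w_def positive_adj)
  have wa: "w * a = a * w" using ha by (simp add: w_def algebra_simps)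
  have wc: "w * c = c * w" by (rule cc[OF wa])
  have wh: "w * h = h * w" using ha by (simp add: w_def algebra_simps)
  have hw: "h * w = - (a * w)" using ha a(2) by (simp add: w_def algebra_simps)
  have "adj (v * w) * (v * w) = w * h * w" by (simp add: wsa h_def mult.assoc)
  also have "\<dots> = - (a * w * w)" by (simp add: wh hw)
  also have "\<dots> = - ((c * w) * (c * w))" by (metis c(2) mult.assoc wc)
  finally have 1: "adj (v * w) * (v * w) = - ((c * w) * (c * w))" .
  have "adj (c * w) = c * w" using c wc by (simp add: wsa positive_adj)
  then have "v * w = 0"
    by (intro eq_0_of_negative_adj_mult_self) (simp add: 1 positive_square del: adj_mult)
  then have "h * w = 0" by (simp add: h_def mult.assoc)
  moreover then have "a * w = 0" using hw by simp
  ultimately have "w * w = 0" by (simp add: w_def algebra_simps)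
  then have "w = 0" using wsa selfadjoint_square_eq_0 by blast
  then show ?thesis using a by (simp add: w_def h_def)
qed

lemma positive_conjugate:
  fixes u c :: "'a::unital_cstar_algebra"
  assumes "positive u"
  shows "positive (adj c * u * c)"
proof -
  obtain s where s: "positive s" "s * s = u" using positive_sqrt[OF assms] by metis
  have "adj c * u * c = adj (s * c) * (s * c)"
    using s positive_adj[OF s(1)] by (auto simp: mult.assoc)
  then show ?thesis using positive_adj_mult_self[of "s * c"] by metis
qed

text \<open>
  The order interval from \<open>0\<close> to \<open>t\<close> is norm bounded by \<open>t\<close>: for \<open>t = 1\<close> the roots \<open>c\<close> of \<open>u\<close> and \<open>d\<close> of
  \<open>1 - u\<close> are the parts of the unitary \<open>c + i d\<close>, so \<open>c\<close> is a contraction.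
\<close>
lemma norm_le_of_positive:
  fixes u :: "'a::unital_cstar_algebra"
  assumes u: "positive u" and le: "positive (t *\<^sub>R 1 - u)" and "0 \<le> t"
  shows "norm u \<le> t"
proof (cases "t = 0")
  case True
  then show ?thesis using positive_antisym[of u] assms by simp
next
  case False
  with \<open>0 \<le> t\<close> have t: "0 < t" by simp
  define g where "g = (1/t) *\<^sub>R u"
  have g: "positive g" using u t by (auto simp: g_def intro: positive_scaleR)
  have "1 - g = (1/t) *\<^sub>R (t *\<^sub>R 1 - u)" using t by (simp add: g_def scaleR_diff_right)
  then have g1: "positive (1 - g)" using le t by (auto intro: positive_scaleR)
  obtain c where c: "positive c" "c * c = g" using positive_sqrt[OF g] by metis
  obtain d where d: "positive d" "d * d = 1 - g"
    and dc: "\<And>z. z * (1 - g) = (1 - g) * z \<Longrightarrow> z * d = d * z"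
    using positive_sqrt[OF g1] by metis
  have "c * d = d * c" by (rule dc) (simp add: c(2)[symmetric] algebra_simps)
  then have "norm c \<le> 1"
    using c d by (intro norm_le_1_of_square_sum[of c d]) (auto simp: positive_adj)
  then have "norm g \<le> 1"
    using norm_mult_ineq[of c c] mult_mono[of "norm c" 1 "norm c" 1] c by simp
  then show ?thesis using t by (simp add: g_def)
qed

text \<open>
  The step from a positive quadratic form to the Cauchy-Schwarz inequality. If \<open>\<alpha>\<close>, \<open>\<beta>\<close> and \<open>c\<close> are the
  values of an algebra-valued form at \<open>(x, x)\<close>, \<open>(y, y)\<close> and \<open>(x, y)\<close>, then \<open>form\<close> is its positivity at
  \<open>x c - t y\<close>. With the bounds \<open>r\<^sup>2\<close> on \<open>\<alpha>\<close> and \<open>s\<^sup>2\<close> on \<open>\<beta>\<close>, the choice \<open>t = r\<^sup>2\<close> yields \<open>c\<^sup>* c \<le> r\<^sup>2 s\<^sup>2\<close>.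
\<close>
lemma norm_mixed_term_le:
  fixes \<alpha> \<beta> c :: "'a::unital_cstar_algebra"
  assumes r: "0 < r" and s: "0 \<le> s"
    and \<alpha>: "positive ((r\<^sup>2) *\<^sub>R 1 - \<alpha>)" and \<beta>: "positive ((s\<^sup>2) *\<^sub>R 1 - \<beta>)"
    and form: "\<And>t. positive (adj c * \<alpha> * c - (2 * t) *\<^sub>R (adj c * c) + t\<^sup>2 *\<^sub>R \<beta>)"
  shows "norm c \<le> r * s"
proof -
  define t where "t = r\<^sup>2"
  define G where "G = (t * s\<^sup>2) *\<^sub>R 1 - adj c * c"
  have double: "(2 * t) *\<^sub>R u = t *\<^sub>R u + t *\<^sub>R u" for u :: 'a
    by (simp add: scaleR_left_distrib[symmetric])
  have "positive (adj c * (t *\<^sub>R 1 - \<alpha>) * c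
      + (adj c * \<alpha> * c - (2 * t) *\<^sub>R (adj c * c) + t\<^sup>2 *\<^sub>R \<beta>) + t\<^sup>2 *\<^sub>R ((s\<^sup>2) *\<^sub>R 1 - \<beta>))"
    using \<alpha> \<beta> by (intro positive_add positive_conjugate form positive_scaleR) (auto simp: t_def)
  also have "adj c * (t *\<^sub>R 1 - \<alpha>) * c = t *\<^sub>R (adj c * c) - adj c * \<alpha> * c"
    by (simp add: algebra_simps)
  also have "t *\<^sub>R (adj c * c) - adj c * \<alpha> * c
      + (adj c * \<alpha> * c - (2 * t) *\<^sub>R (adj c * c) + t\<^sup>2 *\<^sub>R \<beta>) + t\<^sup>2 *\<^sub>R ((s\<^sup>2) *\<^sub>R 1 - \<beta>) = t *\<^sub>R G"
    unfolding double by (simp add: G_def algebra_simps power2_eq_square)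
  finally have "positive ((1/t) *\<^sub>R (t *\<^sub>R G))" by (rule positive_scaleR[rotated]) (simp add: t_def)
  moreover have "t \<noteq> 0" using r by (simp add: t_def)
  ultimately have "positive G" by simp
  then have "norm (adj c * c) \<le> t * s\<^sup>2"
    unfolding G_def by (intro norm_le_of_positive positive_adj_mult_self) (simp_all add: t_def)
  then have "(norm c)\<^sup>2 \<le> (r * s)\<^sup>2"
    by (simp add: norm_adj_mult_self t_def power_mult_distrib del: power2_le_iff_abs_le)
  then show ?thesis
    by (rule power2_le_imp_le) (use r s in simp)
qed

section \<open>Adjoining a unit\<close>

class complex_cstar_algebra = real_cstar_algebra +
  fixes cscale :: "complex \<Rightarrow> 'a \<Rightarrow> 'a"
  assumes cscale_of_real: "cscale (of_real t) u = t *\<^sub>R u"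
    and cscale_add_left: "cscale (k + l) u = cscale k u + cscale l u"
    and cscale_add_right: "cscale k (u + v) = cscale k u + cscale k v"
    and cscale_cscale: "cscale k (cscale l u) = cscale (k * l) u"
    and mult_cscale_left: "cscale k u * v = cscale k (u * v)"
    and mult_cscale_right: "u * cscale k v = cscale k (u * v)"
    and adj_cscale: "adj (cscale k u) = cscale (cnj k) (adj u)"
    and norm_cscale: "norm (cscale k u) = cmod k * norm u"

lemma cscale_scaleR: "cscale k (t *\<^sub>R u) = t *\<^sub>R cscale k (u::'a::complex_cstar_algebra)"
  by (simp add: cscale_of_real[symmetric] cscale_cscale mult.commute)

lemma scaleR_cscale: "cscale (t *\<^sub>R k) u = t *\<^sub>R cscale k (u::'a::complex_cstar_algebra)"
  by (simp add: cscale_of_real[symmetric] cscale_cscale scaleR_conv_of_real)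

datatype 'a unitization = Unitization (scalar_part: complex) (algebra_part: 'a)

instantiation unitization :: (complex_cstar_algebra) ring_1
begin

definition "0 = Unitization 0 0"
definition "1 = Unitization 1 0"
definition "u + v = Unitization (scalar_part u + scalar_part v) (algebra_part u + algebra_part v)"
definition "- u = Unitization (- scalar_part u) (- algebra_part u)"
definition "u - v = Unitization (scalar_part u - scalar_part v) (algebra_part u - algebra_part v)"
definition "u * v = Unitization (scalar_part u * scalar_part v)
  (cscale (scalar_part u) (algebra_part v) + cscale (scalar_part v) (algebra_part u)
    + algebra_part u * algebra_part v)"

lemma scalar_part_simps [simp]:
  "scalar_part (0 :: 'a unitization) = 0" "scalar_part (1 :: 'a unitization) = 1"
  "scalar_part (u + v :: 'a unitization) = scalar_part u + scalar_part v"
  "scalar_part (- u :: 'a unitization) = - scalar_part u"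
  "scalar_part (u - v :: 'a unitization) = scalar_part u - scalar_part v"
  "scalar_part (u * v :: 'a unitization) = scalar_part u * scalar_part v"
  by (simp_all add: zero_unitization_def one_unitization_def plus_unitization_def
      uminus_unitization_def minus_unitization_def times_unitization_def)

lemma algebra_part_simps [simp]:
  "algebra_part (0 :: 'a unitization) = 0" "algebra_part (1 :: 'a unitization) = 0"
  "algebra_part (u + v :: 'a unitization) = algebra_part u + algebra_part v"
  "algebra_part (- u :: 'a unitization) = - algebra_part u"
  "algebra_part (u - v :: 'a unitization) = algebra_part u - algebra_part v"
  "algebra_part (u * v :: 'a unitization) = cscale (scalar_part u) (algebra_part v)
    + cscale (scalar_part v) (algebra_part u) + algebra_part u * algebra_part v"
  by (simp_all add: zero_unitization_def one_unitization_def plus_unitization_def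
      uminus_unitization_def minus_unitization_def times_unitization_def)

lemma cscale_zero_one [simp]:
  "cscale 0 u = 0" "cscale 1 u = u" "cscale k 0 = 0" for u :: "'a::complex_cstar_algebra"
  using cscale_of_real[of 0 u] cscale_of_real[of 1 u] cscale_add_right[of k 0 0] by auto

instance
proof
  fix u v w :: "'a unitization"
  show "u * v * w = u * (v * w)"
    by (rule unitization.expand)
      (simp add: cscale_add_left cscale_add_right cscale_cscale mult_cscale_left mult_cscale_right
        algebra_simps)
  show "(0 :: 'a unitization) \<noteq> 1"
    using scalar_part_simps(1,2) zero_neq_one by metis
qed (rule unitization.expand; simp add: cscale_add_left cscale_add_right algebra_simps)+

end

definition left_action :: "'a::complex_cstar_algebra unitization \<Rightarrow> 'a \<Rightarrow> 'a" where
  "left_action u z = cscale (scalar_part u) z + algebra_part u * z"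

lemma bounded_linear_cscale: "bounded_linear (cscale k :: 'a::complex_cstar_algebra \<Rightarrow> 'a)"
  by (rule bounded_linear_intro[where K = "cmod k"])
    (simp_all add: cscale_scaleR cscale_add_right norm_cscale)

lemma bounded_linear_left_action: "bounded_linear (left_action u)"
  unfolding left_action_def
  by (intro bounded_linear_add bounded_linear_cscale bounded_linear_mult_right)

lemma left_action_mult: "left_action (u * v) z = left_action u (left_action v z)"
  by (simp add: left_action_def cscale_add_right cscale_cscale mult_cscale_left mult_cscale_right
      algebra_simps)

instantiation unitization :: (complex_cstar_algebra) real_normed_vector
begin

text \<open>
  The operator norm of the left action alone is a norm only when the algebra has no unit: with a unit
  \<open>e\<close>, the element \<open>1 - e\<close> acts as zero. The maximum with the modulus of the scalar part is a C*-norm in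
  both cases, and it makes completeness immediate.
\<close>
definition "t *\<^sub>R u = Unitization (t *\<^sub>R scalar_part u) (t *\<^sub>R algebra_part u)"
definition norm_unitization :: "'a unitization \<Rightarrow> real" where
  "norm_unitization u = max (cmod (scalar_part u)) (onorm (left_action u))"
definition sgn_unitization :: "'a unitization \<Rightarrow> 'a unitization" where
  "sgn_unitization u = inverse (norm u) *\<^sub>R u"
definition dist_unitization :: "'a unitization \<Rightarrow> 'a unitization \<Rightarrow> real" where
  "dist_unitization u v = norm (u - v)"
definition uniformity_unitization :: "('a unitization \<times> 'a unitization) filter" where
  "uniformity_unitization = (INF e\<in>{0<..}. principal {(u, v). dist u v < e})"
definition open_unitization :: "'a unitization set \<Rightarrow> bool" where
  "open_unitization U \<longleftrightarrow> (\<forall>u\<in>U. eventually (\<lambda>(u', v). u' = u \<longrightarrow> v \<in> U) uniformity)"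

lemma scaleR_parts [simp]:
  "scalar_part (t *\<^sub>R u :: 'a unitization) = t *\<^sub>R scalar_part u"
  "algebra_part (t *\<^sub>R u :: 'a unitization) = t *\<^sub>R algebra_part u"
  by (simp_all add: scaleR_unitization_def)

lemma norm_scalar_part_le: "cmod (scalar_part u) \<le> norm u" for u :: "'a unitization"
  by (simp add: norm_unitization_def)

lemma norm_left_action_le: "norm (left_action u z) \<le> norm u * norm z" for u :: "'a unitization"
  using onorm[OF bounded_linear_left_action, of u z]
  by (rule order_trans) (simp add: norm_unitization_def mult_right_mono)

lemma norm_unitization_leI:
  fixes u :: "'a unitization"
  assumes "cmod (scalar_part u) \<le> b" "\<And>z. norm (left_action u z) \<le> b * norm z"
  shows "norm u \<le> b"
  unfolding norm_unitization_def using assms order_trans[OF norm_ge_zero assms(1)]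
  by (auto intro: onorm_bound)

text \<open>
  The elements \<open>w = algebra_part u\<close> and \<open>w\<^sup>*\<close> have a product of norm \<open>\<parallel>w\<parallel>\<^sup>2\<close>, so acting on \<open>w\<^sup>*\<close> recovers the
  norm of \<open>w\<close>.
\<close>
lemma norm_algebra_part_le: "norm (algebra_part u) \<le> norm u + cmod (scalar_part u)"
  for u :: "'a unitization"
proof (cases "algebra_part u = 0")
  case True
  then show ?thesis using norm_scalar_part_le[of u] norm_ge_zero[of "scalar_part u"]
    by (simp del: norm_ge_zero)
next
  case False
  define w where "w = algebra_part u"
  have "norm w * norm w = norm (w * adj w)"
    using norm_adj_mult_self[of "adj w"] by (simp add: power2_eq_square)
  also have "w * adj w = left_action u (adj w) - cscale (scalar_part u) (adj w)"
    by (simp add: left_action_def w_def)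
  also have "norm \<dots> \<le> norm u * norm w + cmod (scalar_part u) * norm w"
    using norm_triangle_ineq4[of "left_action u (adj w)" "cscale (scalar_part u) (adj w)"]
      norm_left_action_le[of u "adj w"] by (simp add: norm_cscale)
  finally show ?thesis using False by (simp add: w_def flip: distrib_right)
qed

lemma norm_unitization_le_parts: "norm u \<le> cmod (scalar_part u) + norm (algebra_part u)"
  for u :: "'a unitization"
proof (rule norm_unitization_leI)
  fix z :: 'a
  show "norm (left_action u z) \<le> (cmod (scalar_part u) + norm (algebra_part u)) * norm z"
    unfolding left_action_def distrib_right
    by (intro norm_triangle_mono norm_mult_ineq) (simp add: norm_cscale)
qed simp

instance
proof
  fix u v w :: "'a unitization" and s t :: real
  show "norm u = 0 \<longleftrightarrow> u = 0"
  proof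
    assume "norm u = 0"
    then show "u = 0"
      using norm_scalar_part_le[of u] norm_algebra_part_le[of u] by (intro unitization.expand) simp
  next
    assume "u = 0"
    then show "norm u = 0"
      using norm_unitization_le_parts[of u] norm_scalar_part_le[of u] by simp
  qed
  show "norm (u + v) \<le> norm u + norm v"
  proof (rule norm_unitization_leI)
    show "cmod (scalar_part (u + v)) \<le> norm u + norm v"
      using norm_triangle_ineq[of "scalar_part u" "scalar_part v"]
        norm_scalar_part_le[of u] norm_scalar_part_le[of v] by simp
    show "norm (left_action (u + v) z) \<le> (norm u + norm v) * norm z" for z
    proof -
      have "left_action (u + v) z = left_action u z + left_action v z"
        by (simp add: left_action_def cscale_add_left algebra_simps)
      then show ?thesis
        using norm_triangle_ineq[of "left_action u z" "left_action v z"]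
          norm_left_action_le[of u z] norm_left_action_le[of v z] by (simp add: distrib_right)
    qed
  qed
  show "norm (t *\<^sub>R u) = \<bar>t\<bar> * norm u"
  proof -
    have "left_action (t *\<^sub>R u) = (\<lambda>z. t *\<^sub>R left_action u z)"
      by (simp add: left_action_def scaleR_cscale algebra_simps fun_eq_iff)
    then have "onorm (left_action (t *\<^sub>R u)) = \<bar>t\<bar> * onorm (left_action u)"
      using onorm_scaleR[OF bounded_linear_left_action] by simp
    then show ?thesis by (simp add: norm_unitization_def max_mult_distrib_left)
  qed
  show "dist u v = norm (u - v)" by (rule dist_unitization_def)
  show "sgn u = inverse (norm u) *\<^sub>R u" by (rule sgn_unitization_def)
  show "uniformity = (INF e\<in>{0<..}. principal {(u, v :: 'a unitization). dist u v < e})"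
    by (rule uniformity_unitization_def)
  show "open U \<longleftrightarrow> (\<forall>u\<in>U. eventually (\<lambda>(u', v). u' = u \<longrightarrow> v \<in> U) uniformity)"
    for U :: "'a unitization set"
    by (rule open_unitization_def)
  show "s *\<^sub>R t *\<^sub>R u = (s * t) *\<^sub>R u" by (rule unitization.expand) simp
  show "s *\<^sub>R (u + v) = s *\<^sub>R u + s *\<^sub>R v" by (rule unitization.expand) (simp add: algebra_simps)
  show "(s + t) *\<^sub>R u = s *\<^sub>R u + t *\<^sub>R u" by (rule unitization.expand) (simp add: algebra_simps)
  show "1 *\<^sub>R u = u" by (rule unitization.expand) simp
qed

end

instance unitization :: (complex_cstar_algebra) banach
proof
  fix X :: "nat \<Rightarrow> 'a unitization"
  assume X: "Cauchy X"
  have sc: "Cauchy (\<lambda>n. scalar_part (X n))"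
    unfolding Cauchy_def dist_norm
  proof (intro allI impI)
    fix e :: real assume "0 < e"
    then obtain N where "\<And>m n. N \<le> m \<Longrightarrow> N \<le> n \<Longrightarrow> norm (X m - X n) < e"
      using X unfolding Cauchy_def dist_norm by meson
    then show "\<exists>N. \<forall>m\<ge>N. \<forall>n\<ge>N. cmod (scalar_part (X m) - scalar_part (X n)) < e"
      using norm_scalar_part_le[of "X _ - X _"] by (metis le_less_trans scalar_part_simps(5))
  qed
  have al: "Cauchy (\<lambda>n. algebra_part (X n))"
    unfolding Cauchy_def dist_norm
  proof (intro allI impI)
    fix e :: real assume "0 < e"
    then have "0 < e / 2" by simp
    then obtain N where N: "\<And>m n. N \<le> m \<Longrightarrow> N \<le> n \<Longrightarrow> norm (X m - X n) < e / 2"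
      using X unfolding Cauchy_def dist_norm by meson
    have "norm (algebra_part (X m) - algebra_part (X n)) < e" if "N \<le> m" "N \<le> n" for m n
      using norm_algebra_part_le[of "X m - X n"] norm_scalar_part_le[of "X m - X n"] N[OF that]
      by simp
    then show "\<exists>N. \<forall>m\<ge>N. \<forall>n\<ge>N. norm (algebra_part (X m) - algebra_part (X n)) < e" by blast
  qed
  obtain k where k: "(\<lambda>n. scalar_part (X n)) \<longlonglongrightarrow> k"
    using sc Cauchy_convergent convergent_def by blast
  obtain w where w: "(\<lambda>n. algebra_part (X n)) \<longlonglongrightarrow> w"
    using al Cauchy_convergent convergent_def by blast
  have lim: "(\<lambda>n. cmod (scalar_part (X n) - k) + norm (algebra_part (X n) - w)) \<longlonglongrightarrow> 0"
    using tendsto_add[OF tendsto_norm_zero[OF LIM_zero[OF k]] tendsto_norm_zero[OF LIM_zero[OF w]]]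
    by simp
  have "norm (X n - Unitization k w) \<le> cmod (scalar_part (X n) - k) + norm (algebra_part (X n) - w)"
    for n
    using norm_unitization_le_parts[of "X n - Unitization k w"] by simp
  then have "(\<lambda>n. X n - Unitization k w) \<longlonglongrightarrow> 0"
    by (intro tendsto_0_le[OF lim, where K = 1] always_eventually) simp
  then have "X \<longlonglongrightarrow> Unitization k w"
    by (simp add: LIM_zero_iff)
  then show "convergent X" by (auto simp: convergent_def)
qed

instantiation unitization :: (complex_cstar_algebra) real_cstar_algebra
begin

definition "adj u = Unitization (cnj (scalar_part u)) (adj (algebra_part u))"

lemma adj_parts [simp]:
  "scalar_part (adj u :: 'a unitization) = cnj (scalar_part u)"
  "algebra_part (adj u :: 'a unitization) = adj (algebra_part u)"
  by (simp_all add: adj_unitization_def)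

instance
proof
  fix u v :: "'a unitization" and s t :: real
  show "norm (u * v) \<le> norm u * norm v"
  proof (rule norm_unitization_leI)
    show "cmod (scalar_part (u * v)) \<le> norm u * norm v"
      using mult_mono[OF norm_scalar_part_le[of u] norm_scalar_part_le[of v]]
        order_trans[OF norm_ge_zero norm_scalar_part_le[of u]] by (simp add: norm_mult)
    show "norm (left_action (u * v) z) \<le> norm u * norm v * norm z" for z
    proof -
      have "norm (left_action (u * v) z) \<le> norm u * norm (left_action v z)"
        unfolding left_action_mult by (rule norm_left_action_le)
      also have "\<dots> \<le> norm u * (norm v * norm z)"
        using order_trans[OF norm_ge_zero norm_scalar_part_le[of u]]
        by (intro mult_left_mono norm_left_action_le)
      finally show ?thesis by (simp add: mult.assoc)
    qed
  qed
  show "(norm u)\<^sup>2 \<le> norm (adj u * u)"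
  proof -
    have nonneg: "0 \<le> norm v" for v :: "'a unitization"
      by (rule order_trans[OF norm_ge_zero norm_scalar_part_le])
    have "norm u \<le> sqrt (norm (adj u * u))"
    proof (rule norm_unitization_leI)
      show "cmod (scalar_part u) \<le> sqrt (norm (adj u * u))"
        using norm_scalar_part_le[of "adj u * u"]
        by (intro real_le_rsqrt) (simp add: norm_mult power2_eq_square)
      show "norm (left_action u z) \<le> sqrt (norm (adj u * u)) * norm z" for z
      proof -
        have "adj (left_action u z) * y = adj z * left_action (adj u) y" for y
          by (simp add: left_action_def adj_cscale mult_cscale_left mult_cscale_right algebra_simps)
        then have "(norm (left_action u z))\<^sup>2 = norm (adj z * left_action (adj u * u) z)"
          by (simp add: left_action_mult flip: norm_adj_mult_self)
        also have "\<dots> \<le> norm z * (norm (adj u * u) * norm z)"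
          using mult_left_mono[OF norm_left_action_le[of "adj u * u" z] norm_ge_zero[of z]]
          by (intro order_trans[OF norm_mult_ineq]) simp
        also have "\<dots> = norm (adj u * u) * (norm z)\<^sup>2" by (simp add: power2_eq_square)
        finally have "norm (left_action u z) \<le> sqrt (norm (adj u * u) * (norm z)\<^sup>2)"
          by (rule real_le_rsqrt)
        then show ?thesis by (simp add: real_sqrt_mult)
      qed
    qed
    then show ?thesis using power_mono[of "norm u" _ 2] nonneg by fastforce
  qed
  show "s *\<^sub>R u * v = s *\<^sub>R (u * v)"
    by (rule unitization.expand) (simp add: cscale_scaleR scaleR_cscale algebra_simps)
  show "u * s *\<^sub>R v = s *\<^sub>R (u * v)"
    by (rule unitization.expand) (simp add: cscale_scaleR scaleR_cscale algebra_simps)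
  show "adj (adj u) = u" by (rule unitization.expand) simp
  show "adj (u + v) = adj u + adj v" by (rule unitization.expand) simp
  show "adj (u * v) = adj v * adj u"
    by (rule unitization.expand) (simp add: adj_cscale)
  show "adj (t *\<^sub>R u) = t *\<^sub>R adj u" by (rule unitization.expand) simp
qed

end

instantiation unitization :: (complex_cstar_algebra) unital_cstar_algebra
begin

definition "imag_unit = Unitization \<i> 0"

instance
proof
  fix u :: "'a unitization"
  show "norm (1 :: 'a unitization) = 1"
    using norm_unitization_le_parts[of "1 :: 'a unitization"] norm_scalar_part_le[of "1 :: 'a unitization"]
    by simp
  show "imag_unit * u = u * imag_unit"
    by (rule unitization.expand) (simp add: imag_unit_unitization_def)
  show "imag_unit * imag_unit = (- 1 :: 'a unitization)"
    by (rule unitization.expand) (simp add: imag_unit_unitization_def)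
  show "adj imag_unit = (- imag_unit :: 'a unitization)"
    by (rule unitization.expand) (simp add: imag_unit_unitization_def)
qed

end

definition embed :: "'a::complex_cstar_algebra \<Rightarrow> 'a unitization" where
  "embed w = Unitization 0 w"

lemma embed_simps [simp]:
  "embed 0 = 0" "embed (u + v) = embed u + embed v" "embed (u - v) = embed u - embed v"
  "embed (u * v) = embed u * embed v" "embed (adj u) = adj (embed u)"
  "embed (t *\<^sub>R u) = t *\<^sub>R embed u"
  by (rule unitization.expand; simp add: embed_def)+

lemma embed_sum: "embed (sum f I) = (\<Sum>i\<in>I. embed (f i))"
  by (induction I rule: infinite_finite_induct) auto

lemma norm_embed [simp]: "norm (embed u) = norm u"
  using norm_unitization_le_parts[of "embed u"] norm_algebra_part_le[of "embed u"]
  by (simp add: embed_def)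

section \<open>Covariance in semi-inner product modules\<close>

text \<open>
  Homogeneity of the inner product is derived from the compatibility of the action with scalars.
\<close>
locale semi_inner_product =
  fixes ip :: "'m::real_vector \<Rightarrow> 'm \<Rightarrow> 'a::complex_cstar_algebra"
    and act :: "'m \<Rightarrow> 'a \<Rightarrow> 'm"
  assumes ip_add_right: "ip x (y + z) = ip x y + ip x z"
    and ip_act_right: "ip x (act y u) = ip x y * u"
    and act_scaleR: "act (t *\<^sub>R y) u = act y (t *\<^sub>R u)"
    and adj_ip: "adj (ip x y) = ip y x"
    and ip_self: "\<exists>v. ip x x = adj v * v"
begin

text \<open>
  The two sides agree after multiplication by any \<open>u\<close>, because a scalar can be moved through the
  action onto \<open>u\<close>. Their difference \<open>d\<close> then satisfies \<open>d d\<^sup>* = 0\<close>.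
\<close>
lemma ip_scaleR_right: "ip x (t *\<^sub>R y) = t *\<^sub>R ip x y"
proof -
  define d where "d = ip x (t *\<^sub>R y) - t *\<^sub>R ip x y"
  have "ip x (t *\<^sub>R y) * u = t *\<^sub>R ip x y * u" for u
    by (metis act_scaleR ip_act_right mult_scaleR_left mult_scaleR_right)
  then have "d * adj d = 0" by (simp add: d_def left_diff_distrib)
  then have "adj d = 0" using adj_mult_self_eq_0[of "adj d"] by simp
  then have "d = 0" by (metis adj_adj adj_zero)
  then show ?thesis by (simp add: d_def)
qed

lemma ip_add_left: "ip (x + y) z = ip x z + ip y z"
  by (metis adj_add adj_ip ip_add_right)

lemma ip_scaleR_left: "ip (t *\<^sub>R x) y = t *\<^sub>R ip x y"
  by (metis adj_scaleR adj_ip ip_scaleR_right)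

lemma ip_act_left: "ip (act x u) y = adj u * ip x y"
  by (metis adj_mult adj_ip ip_act_right)

lemma ip_minus_right: "ip x (- y) = - ip x y"
  using ip_scaleR_right[of x "- 1" y] by simp

lemma ip_minus_left: "ip (- x) y = - ip x y"
  using ip_scaleR_left[of "- 1" x y] by simp

lemma ip_diff_right: "ip x (y - z) = ip x y - ip x z"
  using ip_add_right[of x y "- z"] by (simp add: ip_minus_right)

lemma ip_diff_left: "ip (x - y) z = ip x z - ip y z"
  using ip_add_left[of x "- y" z] by (simp add: ip_minus_left)

lemma ip_sum_right: "ip x (sum f I) = (\<Sum>i\<in>I. ip x (f i))"
  using ip_scaleR_right[of x 0]
  by (induction I rule: infinite_finite_induct) (auto simp: ip_add_right)

lemma ip_sum_left: "ip (sum f I) x = (\<Sum>i\<in>I. ip (f i) x)"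
  using ip_scaleR_left[of 0 _ x]
  by (induction I rule: infinite_finite_induct) (auto simp: ip_add_left)

lemma positive_embed_ip_self: "positive (embed (ip x x))"
proof -
  obtain v where "ip x x = adj v * v" using ip_self by blast
  then show ?thesis using positive_adj_mult_self[of "embed v"] by simp
qed

definition covariance :: "'i set \<Rightarrow> ('i \<Rightarrow> real) \<Rightarrow> ('i \<Rightarrow> 'm) \<Rightarrow> ('i \<Rightarrow> 'm) \<Rightarrow> 'a" where
  "covariance I p x y = (\<Sum>i\<in>I. p i *\<^sub>R ip (x i) (y i))
    - ip (\<Sum>i\<in>I. p i *\<^sub>R x i) (\<Sum>i\<in>I. p i *\<^sub>R y i)"

lemma covariance_shift:
  assumes "sum p I = 1"
  shows "covariance I p (\<lambda>i. x i - a) (\<lambda>i. y i - b) = covariance I p x y"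
proof -
  have mean: "(\<Sum>i\<in>I. p i *\<^sub>R (f i - c)) = (\<Sum>i\<in>I. p i *\<^sub>R f i) - c" for f and c :: 'm
    using assms by (simp add: scaleR_diff_right sum_subtractf flip: scaleR_sum_left)
  have "(\<Sum>i\<in>I. p i *\<^sub>R ip a b) = ip a b"
    using assms by (simp flip: scaleR_sum_left)
  moreover have "(\<Sum>i\<in>I. p i *\<^sub>R ip a (y i)) = ip a (\<Sum>i\<in>I. p i *\<^sub>R y i)"
    "(\<Sum>i\<in>I. p i *\<^sub>R ip (x i) b) = ip (\<Sum>i\<in>I. p i *\<^sub>R x i) b"
    by (simp_all add: ip_sum_left ip_sum_right ip_scaleR_left ip_scaleR_right)
  ultimately show ?thesis
    unfolding covariance_def mean
    by (simp add: ip_diff_left ip_diff_right scaleR_diff_right sum_subtractf)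
qed

lemma covariance_centered:
  fixes x y :: "'i \<Rightarrow> 'm"
  assumes "sum p I = 1"
  defines "u \<equiv> \<lambda>i. x i - (\<Sum>i\<in>I. p i *\<^sub>R x i)" and "v \<equiv> \<lambda>i. y i - (\<Sum>i\<in>I. p i *\<^sub>R y i)"
  shows "covariance I p x y = (\<Sum>i\<in>I. p i *\<^sub>R ip (u i) (v i))"
proof -
  have "(\<Sum>i\<in>I. p i *\<^sub>R u i) = 0"
    using assms(1) by (simp add: u_def scaleR_diff_right sum_subtractf flip: scaleR_sum_left)
  moreover have "ip 0 z = 0" for z using ip_scaleR_left[of 0 0 z] by simp
  ultimately have "covariance I p u v = (\<Sum>i\<in>I. p i *\<^sub>R ip (u i) (v i))"
    by (simp add: covariance_def)
  then show ?thesis using covariance_shift[OF assms(1), of x _ y] by (simp add: u_def v_def)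
qed

text \<open>
  The variance is the mean square distance from \<open>a\<close> minus the square of the distance of the mean from
  \<open>a\<close>. This is where the centre \<open>a\<close> of the ball enters.
\<close>
lemma positive_bound_minus_variance:
  assumes p: "\<And>i. i \<in> I \<Longrightarrow> 0 \<le> p i" "sum p I = 1"
    and x: "\<And>i. i \<in> I \<Longrightarrow> norm (ip (x i - a) (x i - a)) \<le> K"
  shows "positive (K *\<^sub>R 1 - embed (covariance I p x x))"
proof -
  define m where "m = (\<Sum>i\<in>I. p i *\<^sub>R (x i - a))"
  have "(\<Sum>i\<in>I. (p i * K) *\<^sub>R (1 :: 'a unitization)) = K *\<^sub>R 1"
    using p(2) by (simp flip: scaleR_sum_left sum_distrib_right)
  moreover have "covariance I p x x = (\<Sum>i\<in>I. p i *\<^sub>R ip (x i - a) (x i - a)) - ip m m"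
    unfolding covariance_shift[OF p(2), of x a x a, symmetric] by (simp add: covariance_def m_def)
  ultimately have "K *\<^sub>R 1 - embed (covariance I p x x)
    = (\<Sum>i\<in>I. p i *\<^sub>R (K *\<^sub>R 1 - embed (ip (x i - a) (x i - a)))) + embed (ip m m)"
    by (simp add: embed_sum scaleR_diff_right sum_subtractf)
  also have "positive \<dots>"
    using p(1) x
    by (intro positive_add positive_sum positive_scaleR positive_bound_minus positive_embed_ip_self)
      (auto simp: adj_ip simp flip: embed_simps(5))
  finally show ?thesis .
qed

text \<open>
  Covariance is itself a semi-inner product on families: its value at \<open>x c - t y\<close> is a weighted sum of
  the squares of the centred vectors \<open>z i\<close>.
\<close>
lemma positive_covariance_form:
  fixes x y :: "'i \<Rightarrow> 'm" and t :: real
  assumes p: "\<And>i. i \<in> I \<Longrightarrow> 0 \<le> p i" "sum p I = 1"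
  defines "c \<equiv> covariance I p x y"
  shows "positive (embed (adj c * covariance I p x x * c - (2 * t) *\<^sub>R (adj c * c)
    + t\<^sup>2 *\<^sub>R covariance I p y y))"
proof -
  define u where "u i = x i - (\<Sum>i\<in>I. p i *\<^sub>R x i)" for i
  define v where "v i = y i - (\<Sum>i\<in>I. p i *\<^sub>R y i)" for i
  define z where "z i = act (u i) c - t *\<^sub>R v i" for i
  have xx: "covariance I p x x = (\<Sum>i\<in>I. p i *\<^sub>R ip (u i) (u i))"
    and xy: "c = (\<Sum>i\<in>I. p i *\<^sub>R ip (u i) (v i))"
    and yy: "covariance I p y y = (\<Sum>i\<in>I. p i *\<^sub>R ip (v i) (v i))"
    by (simp_all add: c_def covariance_centered[OF p(2)] u_def v_def)
  have yx: "adj c = (\<Sum>i\<in>I. p i *\<^sub>R ip (v i) (u i))"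
    unfolding xy by (simp add: adj_sum adj_ip)
  have zz: "ip (z i) (z i) = adj c * ip (u i) (u i) * c - t *\<^sub>R (adj c * ip (u i) (v i))
      - t *\<^sub>R (ip (v i) (u i) * c) + t\<^sup>2 *\<^sub>R ip (v i) (v i)" for i
    by (simp add: z_def ip_diff_left ip_diff_right ip_act_left ip_act_right ip_scaleR_left
        ip_scaleR_right power2_eq_square algebra_simps)
  have "(\<Sum>i\<in>I. p i *\<^sub>R ip (z i) (z i)) = adj c * (\<Sum>i\<in>I. p i *\<^sub>R ip (u i) (u i)) * c
      - t *\<^sub>R (adj c * (\<Sum>i\<in>I. p i *\<^sub>R ip (u i) (v i)))
      - t *\<^sub>R ((\<Sum>i\<in>I. p i *\<^sub>R ip (v i) (u i)) * c) + t\<^sup>2 *\<^sub>R (\<Sum>i\<in>I. p i *\<^sub>R ip (v i) (v i))"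
    by (simp add: zz sum.distrib sum_subtractf scaleR_diff_right scaleR_add_right sum_distrib_left
        sum_distrib_right scaleR_sum_right mult.commute)
  also have "\<dots> = adj c * covariance I p x x * c - t *\<^sub>R (adj c * c) - t *\<^sub>R (adj c * c)
      + t\<^sup>2 *\<^sub>R covariance I p y y"
    by (simp only: xx[symmetric] xy[symmetric] yx[symmetric] yy[symmetric])
  also have "\<dots> = adj c * covariance I p x x * c - (2 * t) *\<^sub>R (adj c * c)
      + t\<^sup>2 *\<^sub>R covariance I p y y"
    by (simp only: diff_diff_eq flip: mult_2 scaleR_left_distrib)
  finally have eq: "(\<Sum>i\<in>I. p i *\<^sub>R ip (z i) (z i)) = adj c * covariance I p x x * c
      - (2 * t) *\<^sub>R (adj c * c) + t\<^sup>2 *\<^sub>R covariance I p y y" .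
  have "positive (embed (\<Sum>i\<in>I. p i *\<^sub>R ip (z i) (z i)))"
    using p(1) by (simp add: embed_sum positive_sum positive_scaleR positive_embed_ip_self)
  then show ?thesis unfolding eq .
qed

theorem norm_covariance_le:
  assumes p: "\<And>i. i \<in> I \<Longrightarrow> 0 \<le> p i" "sum p I = 1"
    and r: "0 \<le> r" "\<And>i. i \<in> I \<Longrightarrow> norm (ip (x i - a) (x i - a)) \<le> r\<^sup>2"
    and s: "0 \<le> s" "\<And>i. i \<in> I \<Longrightarrow> norm (ip (y i - b) (y i - b)) \<le> s\<^sup>2"
  shows "norm (covariance I p x y) \<le> r * s"
proof -
  \<comment> \<open>The mixed term estimate divides by the radius, so it is applied to every \<open>R > r\<close>, and
    \<open>R\<close> then decreases to \<open>r\<close>; this includes \<open>r = 0\<close>.\<close>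
  have bound: "norm (covariance I p x y) \<le> R * s" if "r < R" for R
  proof -
    have R: "norm (ip (x i - a) (x i - a)) \<le> R\<^sup>2" if "i \<in> I" for i
      using r(2)[OF that] power_mono[of r R 2] \<open>r < R\<close> r(1) by linarith
    have "norm (embed (covariance I p x y)) \<le> R * s"
      using norm_mixed_term_le[OF _ s(1) positive_bound_minus_variance[OF p R]
          positive_bound_minus_variance[OF p s(2)], where c = "embed (covariance I p x y)"]
        positive_covariance_form[OF p, of x y] r(1) \<open>r < R\<close>
      by simp
    then show ?thesis by simp
  qed
  show ?thesis
  proof (rule tendsto_lowerbound)
    show "((\<lambda>R. R * s) \<longlongrightarrow> r * s) (at_right r)" by (intro tendsto_intros)
    show "eventually (\<lambda>R. norm (covariance I p x y) \<le> R * s) (at_right r)"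
      using bound by (auto simp: eventually_at_filter)
  qed simp
qed

end

section \<open>From types to carrier sets\<close>

lemma complex_ring_simps [simp]:
  "carrier complex_ring = UNIV" "k \<otimes>\<^bsub>complex_ring\<^esub> l = k * l" "\<one>\<^bsub>complex_ring\<^esub> = 1"
  "\<zero>\<^bsub>complex_ring\<^esub> = 0" "k \<oplus>\<^bsub>complex_ring\<^esub> l = k + l"
  by (simp_all add: complex_ring_def)

lemma cring_complex_ring: "cring complex_ring"
proof (rule cringI)
  show "abelian_group complex_ring"
    by (rule abelian_groupI) (auto simp: algebra_simps intro: exI[of _ "- _"] ab_left_minus)
  show "comm_monoid complex_ring"
    by (rule comm_monoidI) (auto simp: algebra_simps)
qed (simp add: algebra_simps)

definition gruss_bound :: "'a cstar \<Rightarrow> ('a, 'x) ip_module \<Rightarrow> bool" where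
  "gruss_bound A X \<longleftrightarrow> (\<forall>(n :: nat) p a b x y (r :: real) (s :: real).
    probability_vector n p \<and> a \<in> carrier X \<and> b \<in> carrier X \<and>
    x \<in> {1..n} \<rightarrow> carrier X \<and> y \<in> {1..n} \<rightarrow> carrier X \<and> 0 \<le> r \<and> 0 \<le> s \<and>
    (\<forall>i\<in>{1..n}. xnorm A X (x i \<ominus>\<^bsub>X\<^esub> a) \<le> r \<and> xnorm A X (y i \<ominus>\<^bsub>X\<^esub> b) \<le> s)
    \<longrightarrow> cnorm A ((\<Oplus>\<^bsub>A\<^esub>i\<in>{1..n}. of_real (p i) \<odot>\<^bsub>A\<^esub> ip X (x i) (y i)) \<ominus>\<^bsub>A\<^esub>
      ip X (\<Oplus>\<^bsub>X\<^esub>i\<in>{1..n}. of_real (p i) \<odot>\<^bsub>X\<^esub> x i) (\<Oplus>\<^bsub>X\<^esub>i\<in>{1..n}. of_real (p i) \<odot>\<^bsub>X\<^esub> y i))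
      \<le> r * s)"

text \<open>
  The zero module over the zero algebra, which exists on every pair of types.
\<close>
definition trivial_cstar :: "'a cstar" where
  "trivial_cstar = \<lparr>carrier = {undefined}, mult = (\<lambda>_ _. undefined), one = undefined,
    zero = undefined, add = (\<lambda>_ _. undefined), smult = (\<lambda>_ _. undefined),
    star = (\<lambda>_. undefined), cnorm = (\<lambda>_. 0)\<rparr>"

definition trivial_ip_module :: "('a, 'x) ip_module" where
  "trivial_ip_module = \<lparr>carrier = {undefined}, mult = (\<lambda>_ _. undefined), one = undefined,
    zero = undefined, add = (\<lambda>_ _. undefined), smult = (\<lambda>_ _. undefined),
    ract = (\<lambda>_ _. undefined), ip = (\<lambda>_ _. undefined)\<rparr>"

lemma trivial_semi_inner_product_module:
  "semi_inner_product_module (trivial_cstar :: 'a cstar) (trivial_ip_module :: ('a, 'x) ip_module)"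
proof -
  have A: "module complex_ring (trivial_cstar :: 'a cstar)"
    by (intro moduleI cring_complex_ring abelian_groupI) (simp_all add: trivial_cstar_def)
  have X: "module complex_ring (trivial_ip_module :: ('a, 'x) ip_module)"
    by (intro moduleI cring_complex_ring abelian_groupI) (simp_all add: trivial_ip_module_def)
  have "cstar_algebra (trivial_cstar :: 'a cstar)"
    by (intro cstar_algebra.intro A cstar_algebra_axioms.intro) (simp_all add: trivial_cstar_def)
  then show ?thesis
    by (intro semi_inner_product_module.intro X semi_inner_product_module_axioms.intro)
      (simp_all add: trivial_cstar_def trivial_ip_module_def cstar_pos_def)
qed

text \<open>
  Types of coefficients and vectors cannot depend on an algebra and a module that are variables, but
  they can be carved out of one fixed pair. The pair chosen here violates the bound if any pair on the
  given types does; so it suffices to prove the bound for this single pair.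
\<close>
definition critical_pair :: "'a cstar \<times> ('a, 'x) ip_module" where
  "critical_pair = (SOME (A, X). semi_inner_product_module A X \<and>
    (gruss_bound A X \<longrightarrow> (\<forall>B (Y :: ('a, 'x) ip_module). semi_inner_product_module B Y \<longrightarrow> gruss_bound B Y)))"

definition critical_cstar :: "'x itself \<Rightarrow> 'a cstar" where
  "critical_cstar _ = fst (critical_pair :: 'a cstar \<times> ('a, 'x) ip_module)"

definition critical_module :: "('a, 'x) ip_module" where
  "critical_module = snd (critical_pair :: 'a cstar \<times> ('a, 'x) ip_module)"

lemma
  shows semi_inner_product_module_critical:
    "semi_inner_product_module (critical_cstar TYPE('x) :: 'a cstar) (critical_module :: ('a, 'x) ip_module)"
    and gruss_bound_if_critical:
    "gruss_bound (critical_cstar TYPE('x) :: 'a cstar) (critical_module :: ('a, 'x) ip_module)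
      \<Longrightarrow> semi_inner_product_module B (Y :: ('a, 'x) ip_module) \<Longrightarrow> gruss_bound B Y"
proof -
  let ?P = "\<lambda>(A :: 'a cstar, X :: ('a, 'x) ip_module). semi_inner_product_module A X \<and>
    (gruss_bound A X \<longrightarrow> (\<forall>B (Y :: ('a, 'x) ip_module). semi_inner_product_module B Y \<longrightarrow> gruss_bound B Y))"
  have "\<exists>Z. ?P Z"
  proof (cases "\<exists>A (X :: ('a, 'x) ip_module). semi_inner_product_module A X \<and> \<not> gruss_bound A X")
    case True
    then show ?thesis by auto
  next
    case False
    then have "?P (trivial_cstar, trivial_ip_module)"
      using trivial_semi_inner_product_module by auto
    then show ?thesis by blast
  qed
  then have "?P critical_pair" unfolding critical_pair_def by (rule someI_ex)
  then have "?P (critical_cstar TYPE('x), critical_module)"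
    by (simp add: critical_cstar_def critical_module_def)
  then show "semi_inner_product_module (critical_cstar TYPE('x) :: 'a cstar) (critical_module :: ('a, 'x) ip_module)"
    and "gruss_bound (critical_cstar TYPE('x) :: 'a cstar) (critical_module :: ('a, 'x) ip_module)
      \<Longrightarrow> semi_inner_product_module B (Y :: ('a, 'x) ip_module) \<Longrightarrow> gruss_bound B Y"
    by auto
qed

interpretation critical: semi_inner_product_module
  "critical_cstar TYPE('x) :: 'a cstar" "critical_module :: ('a, 'x) ip_module"
  by (rule semi_inner_product_module_critical)

text \<open>
  The type \<open>'x\<close> occurs in the type of coefficients because algebra and module are chosen together.
\<close>
typedef ('a, 'x) coefficient = "carrier (critical_cstar TYPE('x) :: 'a cstar)"
  using critical.A.zero_closed by blast

typedef ('a, 'x) vector = "carrier (critical_module :: ('a, 'x) ip_module)"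
  using critical.X.zero_closed by blast

setup_lifting type_definition_coefficient
setup_lifting type_definition_vector

lemmas critical_smult_closed =
  critical.A.smult_closed[simplified] critical.X.smult_closed[simplified]

instantiation coefficient :: (type, type) real_normed_vector
begin

lift_definition zero_coefficient :: "('a, 'b) coefficient"
  is "zero (critical_cstar TYPE('b) :: 'a cstar)" by simp
lift_definition plus_coefficient :: "('a, 'b) coefficient \<Rightarrow> ('a, 'b) coefficient \<Rightarrow> ('a, 'b) coefficient"
  is "add (critical_cstar TYPE('b) :: 'a cstar)" by simp
lift_definition minus_coefficient :: "('a, 'b) coefficient \<Rightarrow> ('a, 'b) coefficient \<Rightarrow> ('a, 'b) coefficient"
  is "a_minus (critical_cstar TYPE('b) :: 'a cstar)" by simp
lift_definition uminus_coefficient :: "('a, 'b) coefficient \<Rightarrow> ('a, 'b) coefficient"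
  is "a_inv (critical_cstar TYPE('b) :: 'a cstar)" by simp
lift_definition scaleR_coefficient :: "real \<Rightarrow> ('a, 'b) coefficient \<Rightarrow> ('a, 'b) coefficient"
  is "\<lambda>t. smult (critical_cstar TYPE('b) :: 'a cstar) (of_real t)" by (rule critical_smult_closed)
lift_definition norm_coefficient :: "('a, 'b) coefficient \<Rightarrow> real"
  is "cnorm (critical_cstar TYPE('b) :: 'a cstar)" .
definition sgn_coefficient :: "('a, 'b) coefficient \<Rightarrow> ('a, 'b) coefficient" where
  "sgn_coefficient u = inverse (norm u) *\<^sub>R u"
definition dist_coefficient :: "('a, 'b) coefficient \<Rightarrow> ('a, 'b) coefficient \<Rightarrow> real" where
  "dist_coefficient u v = norm (u - v)"
definition uniformity_coefficient :: "(('a, 'b) coefficient \<times> ('a, 'b) coefficient) filter" where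
  "uniformity_coefficient = (INF e\<in>{0<..}. principal {(u, v). dist u v < e})"
definition open_coefficient :: "('a, 'b) coefficient set \<Rightarrow> bool" where
  "open_coefficient U \<longleftrightarrow> (\<forall>u\<in>U. eventually (\<lambda>(u', v). u' = u \<longrightarrow> v \<in> U) uniformity)"

instance
proof
  fix u v w :: "('a, 'b) coefficient" and s t :: real
  show "u + v + w = u + (v + w)" by transfer (rule critical.A.a_assoc)
  show "u + v = v + u" by transfer (rule critical.A.a_comm)
  show "0 + u = u" by transfer (rule critical.A.l_zero)
  show "- u + u = 0" by transfer (rule critical.A.l_neg)
  show "u - v = u + - v" by transfer (rule a_minus_def)
  show "t *\<^sub>R (u + v) = t *\<^sub>R u + t *\<^sub>R v"
    by transfer (simp add: critical.A.smult_r_distr)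
  show "(s + t) *\<^sub>R u = s *\<^sub>R u + t *\<^sub>R u" by transfer (simp add: critical.A.smult_l_distr[simplified])
  show "s *\<^sub>R t *\<^sub>R u = (s * t) *\<^sub>R u" by transfer (simp add: critical.A.smult_assoc1[simplified])
  show "1 *\<^sub>R u = u" by transfer (simp add: critical.A.smult_one[simplified])
  show "norm u = 0 \<longleftrightarrow> u = 0" by transfer (rule critical.A.cnorm_eq_0)
  show "norm (u + v) \<le> norm u + norm v" by transfer (rule critical.A.cnorm_add)
  show "norm (t *\<^sub>R u) = \<bar>t\<bar> * norm u" by transfer (simp add: critical.A.cnorm_smult)
  show "dist u v = norm (u - v)" by (rule dist_coefficient_def)
  show "sgn u = inverse (norm u) *\<^sub>R u" by (rule sgn_coefficient_def)
  show "uniformity = (INF e\<in>{0<..}. principal {(u, v :: ('a, 'b) coefficient). dist u v < e})"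
    by (rule uniformity_coefficient_def)
  show "open U \<longleftrightarrow> (\<forall>u\<in>U. eventually (\<lambda>(u', v). u' = u \<longrightarrow> v \<in> U) uniformity)"
    for U :: "('a, 'b) coefficient set"
    by (rule open_coefficient_def)
qed

end

instance coefficient :: (type, type) banach
proof
  fix X :: "nat \<Rightarrow> ('a, 'b) coefficient"
  let ?A = "critical_cstar TYPE('b) :: 'a cstar"
  define f where "f i = Rep_coefficient (X i)" for i
  assume "Cauchy X"
  then have "\<forall>\<epsilon>>0. \<exists>N. \<forall>i\<ge>N. \<forall>j\<ge>N. cnorm ?A (f i \<ominus>\<^bsub>?A\<^esub> f j) < \<epsilon>"
    by (simp add: Cauchy_def dist_norm norm_coefficient.rep_eq minus_coefficient.rep_eq f_def)
  moreover have "range f \<subseteq> carrier ?A" using Rep_coefficient by (auto simp: f_def)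
  ultimately obtain l where l: "l \<in> carrier ?A" "(\<lambda>i. cnorm ?A (f i \<ominus>\<^bsub>?A\<^esub> l)) \<longlonglongrightarrow> 0"
    using critical.A.complete by blast
  have "(\<lambda>i. norm (X i - Abs_coefficient l)) \<longlonglongrightarrow> 0"
    using l by (simp add: norm_coefficient.rep_eq minus_coefficient.rep_eq f_def Abs_coefficient_inverse)
  then have "X \<longlonglongrightarrow> Abs_coefficient l" by (simp add: tendsto_norm_zero_iff LIM_zero_iff)
  then show "convergent X" by (auto simp: convergent_def)
qed

instantiation coefficient :: (type, type) complex_cstar_algebra
begin

lift_definition times_coefficient :: "('a, 'b) coefficient \<Rightarrow> ('a, 'b) coefficient \<Rightarrow> ('a, 'b) coefficient"
  is "mult (critical_cstar TYPE('b) :: 'a cstar)" by (rule critical.A.mult_closed)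
lift_definition adj_coefficient :: "('a, 'b) coefficient \<Rightarrow> ('a, 'b) coefficient"
  is "star (critical_cstar TYPE('b) :: 'a cstar)" by (rule critical.A.star_closed)
lift_definition cscale_coefficient :: "complex \<Rightarrow> ('a, 'b) coefficient \<Rightarrow> ('a, 'b) coefficient"
  is "smult (critical_cstar TYPE('b) :: 'a cstar)" by (rule critical_smult_closed)

instance
proof
  fix u v w :: "('a, 'b) coefficient" and t :: real and k l :: complex
  show "u * v * w = u * (v * w)" by transfer (rule critical.A.mult_assoc)
  show "(u + v) * w = u * w + v * w" by transfer (rule critical.A.mult_l_distr)
  show "u * (v + w) = u * v + u * w" by transfer (rule critical.A.mult_r_distr)
  show "t *\<^sub>R u * v = t *\<^sub>R (u * v)" by transfer (rule critical.A.mult_smult_l)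
  show "u * t *\<^sub>R v = t *\<^sub>R (u * v)" by transfer (rule critical.A.mult_smult_r)
  show "norm (u * v) \<le> norm u * norm v" by transfer (rule critical.A.cnorm_mult)
  show "adj (adj u) = u" by transfer (rule critical.A.star_star)
  show "adj (u + v) = adj u + adj v" by transfer (rule critical.A.star_add)
  show "adj (u * v) = adj v * adj u" by transfer (rule critical.A.star_mult)
  show "adj (t *\<^sub>R u) = t *\<^sub>R adj u" by transfer (simp add: critical.A.star_smult)
  show "(norm u)\<^sup>2 \<le> norm (adj u * u)" by transfer (simp add: critical.A.cstar_identity)
  show "cscale (of_real t) u = t *\<^sub>R u" by transfer (rule refl)
  show "cscale (k + l) u = cscale k u + cscale l u" by transfer (simp add: critical.A.smult_l_distr[simplified])
  show "cscale k (u + v) = cscale k u + cscale k v"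
    by transfer (simp add: critical.A.smult_r_distr)
  show "cscale k (cscale l u) = cscale (k * l) u" by transfer (simp add: critical.A.smult_assoc1[simplified])
  show "cscale k u * v = cscale k (u * v)" by transfer (rule critical.A.mult_smult_l)
  show "u * cscale k v = cscale k (u * v)" by transfer (rule critical.A.mult_smult_r)
  show "adj (cscale k u) = cscale (cnj k) (adj u)" by transfer (rule critical.A.star_smult)
  show "norm (cscale k u) = cmod k * norm u" by transfer (rule critical.A.cnorm_smult)
qed

end

instantiation vector :: (type, type) real_vector
begin

lift_definition zero_vector :: "('a, 'b) vector"
  is "zero (critical_module :: ('a, 'b) ip_module)" by simp
lift_definition plus_vector :: "('a, 'b) vector \<Rightarrow> ('a, 'b) vector \<Rightarrow> ('a, 'b) vector"
  is "add (critical_module :: ('a, 'b) ip_module)" by simp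
lift_definition minus_vector :: "('a, 'b) vector \<Rightarrow> ('a, 'b) vector \<Rightarrow> ('a, 'b) vector"
  is "a_minus (critical_module :: ('a, 'b) ip_module)" by simp
lift_definition uminus_vector :: "('a, 'b) vector \<Rightarrow> ('a, 'b) vector"
  is "a_inv (critical_module :: ('a, 'b) ip_module)" by simp
lift_definition scaleR_vector :: "real \<Rightarrow> ('a, 'b) vector \<Rightarrow> ('a, 'b) vector"
  is "\<lambda>t. smult (critical_module :: ('a, 'b) ip_module) (of_real t)" by (rule critical_smult_closed)

instance
proof
  fix x y z :: "('a, 'b) vector" and s t :: real
  show "x + y + z = x + (y + z)" by transfer (rule critical.X.a_assoc)
  show "x + y = y + x" by transfer (rule critical.X.a_comm)
  show "0 + x = x" by transfer (rule critical.X.l_zero)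
  show "- x + x = 0" by transfer (rule critical.X.l_neg)
  show "x - y = x + - y" by transfer (rule a_minus_def)
  show "t *\<^sub>R (x + y) = t *\<^sub>R x + t *\<^sub>R y"
    by transfer (simp add: critical.X.smult_r_distr)
  show "(s + t) *\<^sub>R x = s *\<^sub>R x + t *\<^sub>R x" by transfer (simp add: critical.X.smult_l_distr[simplified])
  show "s *\<^sub>R t *\<^sub>R x = (s * t) *\<^sub>R x" by transfer (simp add: critical.X.smult_assoc1[simplified])
  show "1 *\<^sub>R x = x" by transfer (simp add: critical.X.smult_one[simplified])
qed

end

lift_definition vector_ip :: "('a, 'x) vector \<Rightarrow> ('a, 'x) vector \<Rightarrow> ('a, 'x) coefficient"
  is "ip (critical_module :: ('a, 'x) ip_module)" by (rule critical.ip_closed)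

lift_definition vector_act :: "('a, 'x) vector \<Rightarrow> ('a, 'x) coefficient \<Rightarrow> ('a, 'x) vector"
  is "ract (critical_module :: ('a, 'x) ip_module)" by (rule critical.ract_closed)

interpretation vector: semi_inner_product vector_ip vector_act
proof
  fix x y z :: "('a, 'x) vector" and u :: "('a, 'x) coefficient" and t :: real
  show "vector_ip x (y + z) = vector_ip x y + vector_ip x z" by transfer (rule critical.ip_add)
  show "vector_ip x (vector_act y u) = vector_ip x y * u" by transfer (rule critical.ip_ract)
  show "vector_act (t *\<^sub>R y) u = vector_act y (t *\<^sub>R u)"
    by transfer (simp add: critical.ract_smult_l critical.ract_smult_r)
  show "adj (vector_ip x y) = vector_ip y x" by transfer (rule critical.ip_star)
  show "\<exists>v. vector_ip x x = adj v * v" by transfer (use critical.ip_pos in \<open>auto simp: cstar_pos_def\<close>)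
qed

lemma Rep_coefficient_sum:
  fixes f :: "'i \<Rightarrow> ('a, 'x) coefficient"
  shows "finite I \<Longrightarrow> Rep_coefficient (\<Sum>i\<in>I. f i) = (\<Oplus>\<^bsub>critical_cstar TYPE('x)\<^esub>i\<in>I. Rep_coefficient (f i))"
proof (induction I rule: finite_induct)
  case empty
  then show ?case by (simp add: zero_coefficient.rep_eq)
next
  case (insert i I)
  then show ?case
    using Rep_coefficient[of "f _"]
    by (simp add: plus_coefficient.rep_eq critical.A.finsum_insert Pi_def)
qed

lemma Rep_vector_sum:
  fixes f :: "'i \<Rightarrow> ('a, 'x) vector"
  shows "finite I \<Longrightarrow> Rep_vector (\<Sum>i\<in>I. f i)
    = (\<Oplus>\<^bsub>critical_module :: ('a, 'x) ip_module\<^esub>i\<in>I. Rep_vector (f i))"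
proof (induction I rule: finite_induct)
  case empty
  then show ?case by (simp add: zero_vector.rep_eq)
next
  case (insert i I)
  then show ?case
    using Rep_vector[of "f _"]
    by (simp add: plus_vector.rep_eq critical.X.finsum_insert Pi_def)
qed

lemma gruss_bound_critical:
  "gruss_bound (critical_cstar TYPE('x) :: 'a cstar) (critical_module :: ('a, 'x) ip_module)"
  unfolding gruss_bound_def
proof (intro allI impI, elim conjE)
  let ?A = "critical_cstar TYPE('x) :: 'a cstar"
  let ?X = "critical_module :: ('a, 'x) ip_module"
  fix n :: nat and p :: "nat \<Rightarrow> real" and a b :: 'x and x y :: "nat \<Rightarrow> 'x" and r s :: real
  assume p: "probability_vector n p" and a: "a \<in> carrier ?X" and b: "b \<in> carrier ?X"
    and x: "x \<in> {1..n} \<rightarrow> carrier ?X" and y: "y \<in> {1..n} \<rightarrow> carrier ?X"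
    and r: "0 \<le> r" and s: "0 \<le> s"
    and bound: "\<forall>i\<in>{1..n}. xnorm ?A ?X (x i \<ominus>\<^bsub>?X\<^esub> a) \<le> r \<and> xnorm ?A ?X (y i \<ominus>\<^bsub>?X\<^esub> b) \<le> s"
  define x' :: "nat \<Rightarrow> ('a, 'x) vector" where "x' i = Abs_vector (x i)" for i
  define y' :: "nat \<Rightarrow> ('a, 'x) vector" where "y' i = Abs_vector (y i)" for i
  define a' :: "('a, 'x) vector" where "a' = Abs_vector a"
  define b' :: "('a, 'x) vector" where "b' = Abs_vector b"
  have rep: "Rep_vector a' = a" "Rep_vector b' = b"
    "\<And>i. i \<in> {1..n} \<Longrightarrow> Rep_vector (x' i) = x i" "\<And>i. i \<in> {1..n} \<Longrightarrow> Rep_vector (y' i) = y i"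
    by (simp_all add: a b Pi_mem[OF x] Pi_mem[OF y] a'_def b'_def x'_def y'_def Abs_vector_inverse)
  have norm_le: "norm (vector_ip z z) \<le> t\<^sup>2" if "xnorm ?A ?X (Rep_vector z) \<le> t"
    for z :: "('a, 'x) vector" and t
  proof -
    have "sqrt (norm (vector_ip z z)) \<le> t"
      using that by (simp add: xnorm_def norm_coefficient.rep_eq vector_ip.rep_eq)
    then show ?thesis by (rule sqrt_le_D)
  qed
  have "norm (vector.covariance {1..n} p x' y') \<le> r * s"
  proof (rule vector.norm_covariance_le)
    show "norm (vector_ip (x' i - a') (x' i - a')) \<le> r\<^sup>2" if "i \<in> {1..n}" for i
      using bound that by (intro norm_le) (simp add: minus_vector.rep_eq rep)
    show "norm (vector_ip (y' i - b') (y' i - b')) \<le> s\<^sup>2" if "i \<in> {1..n}" for i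
      using bound that by (intro norm_le) (simp add: minus_vector.rep_eq rep)
  qed (use p r s in \<open>auto simp: probability_vector_def\<close>)
  moreover have "Rep_vector (\<Sum>i=1..n. p i *\<^sub>R x' i) = (\<Oplus>\<^bsub>?X\<^esub>i\<in>{1..n}. of_real (p i) \<odot>\<^bsub>?X\<^esub> x i)"
    using x by (auto simp: Rep_vector_sum scaleR_vector.rep_eq rep critical_smult_closed intro!: critical.X.finsum_cong')
  moreover have "Rep_vector (\<Sum>i=1..n. p i *\<^sub>R y' i) = (\<Oplus>\<^bsub>?X\<^esub>i\<in>{1..n}. of_real (p i) \<odot>\<^bsub>?X\<^esub> y i)"
    using y by (auto simp: Rep_vector_sum scaleR_vector.rep_eq rep critical_smult_closed intro!: critical.X.finsum_cong')
  moreover have "Rep_coefficient (\<Sum>i=1..n. p i *\<^sub>R vector_ip (x' i) (y' i))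
      = (\<Oplus>\<^bsub>?A\<^esub>i\<in>{1..n}. of_real (p i) \<odot>\<^bsub>?A\<^esub> ip ?X (x i) (y i))"
    using x y
    by (auto simp: Rep_coefficient_sum scaleR_coefficient.rep_eq vector_ip.rep_eq rep critical_smult_closed
        critical.ip_closed Pi_def intro!: critical.A.finsum_cong')
  ultimately show "cnorm ?A ((\<Oplus>\<^bsub>?A\<^esub>i\<in>{1..n}. of_real (p i) \<odot>\<^bsub>?A\<^esub> ip ?X (x i) (y i)) \<ominus>\<^bsub>?A\<^esub>
      ip ?X (\<Oplus>\<^bsub>?X\<^esub>i\<in>{1..n}. of_real (p i) \<odot>\<^bsub>?X\<^esub> x i) (\<Oplus>\<^bsub>?X\<^esub>i\<in>{1..n}. of_real (p i) \<odot>\<^bsub>?X\<^esub> y i))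
      \<le> r * s"
    by (simp add: vector.covariance_def norm_coefficient.rep_eq minus_coefficient.rep_eq vector_ip.rep_eq)
qed

theorem gruss_bound: "semi_inner_product_module A X \<Longrightarrow> gruss_bound A X"
  using gruss_bound_if_critical gruss_bound_critical by blast

section \<open>Sharpness of the constant\<close>

definition complex_cstar :: "complex cstar" where
  "complex_cstar = \<lparr>carrier = UNIV, mult = (*), one = 1, zero = 0, add = (+), smult = (*),
    star = cnj, cnorm = cmod\<rparr>"

definition complex_ip_module :: "(complex, complex) ip_module" where
  "complex_ip_module = \<lparr>carrier = UNIV, mult = (*), one = 1, zero = 0, add = (+), smult = (*),
    ract = (*), ip = (\<lambda>x y. cnj x * y)\<rparr>"

lemma complex_additive_group:
  fixes R :: "(complex, 'b) ring_scheme"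
  assumes "carrier R = UNIV" "zero R = 0" "add R = (+)"
  shows "abelian_group R" "a_minus R x y = x - y"
proof -
  show R: "abelian_group R"
    by (rule abelian_groupI) (auto simp: assms algebra_simps intro: exI[of _ "- _"] ab_left_minus)
  have "\<ominus>\<^bsub>R\<^esub> y = - y"
    by (rule abelian_group.minus_equality[OF R]) (simp_all add: assms)
  then show "a_minus R x y = x - y" by (simp add: a_minus_def assms)
qed

lemma complex_semi_inner_product_module:
  "semi_inner_product_module complex_cstar complex_ip_module"
proof -
  have A: "module complex_ring complex_cstar"
    by (intro moduleI cring_complex_ring complex_additive_group) (simp_all add: complex_cstar_def algebra_simps)
  have X: "module complex_ring complex_ip_module"
    by (intro moduleI cring_complex_ring complex_additive_group) (simp_all add: complex_ip_module_def algebra_simps)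
  have minus: "a_minus complex_cstar u v = u - v" for u v
    by (rule complex_additive_group) (simp_all add: complex_cstar_def)
  have "cstar_algebra complex_cstar"
  proof (intro cstar_algebra.intro A cstar_algebra_axioms.intro)
    fix f :: "nat \<Rightarrow> complex"
    assume "\<forall>\<epsilon>>0. \<exists>N. \<forall>i\<ge>N. \<forall>j\<ge>N. cnorm complex_cstar (f i \<ominus>\<^bsub>complex_cstar\<^esub> f j) < \<epsilon>"
    then have "Cauchy f" unfolding minus by (simp add: complex_cstar_def Cauchy_def dist_norm)
    then obtain l where "f \<longlonglongrightarrow> l" using Cauchy_convergent convergent_def by blast
    then have "(\<lambda>i. cmod (f i - l)) \<longlonglongrightarrow> 0" by (simp add: tendsto_norm_zero_iff LIM_zero_iff)
    then show "\<exists>l\<in>carrier complex_cstar.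
        (\<lambda>i. cnorm complex_cstar (f i \<ominus>\<^bsub>complex_cstar\<^esub> l)) \<longlonglongrightarrow> 0"
      unfolding minus by (auto simp: complex_cstar_def)
  qed (simp_all add: complex_cstar_def algebra_simps norm_mult norm_triangle_ineq power2_eq_square)
  then show ?thesis
    by (intro semi_inner_product_module.intro X semi_inner_product_module_axioms.intro)
      (auto simp: complex_cstar_def complex_ip_module_def cstar_pos_def algebra_simps)
qed

text \<open>
  For the numbers \<open>1\<close> and \<open>-1\<close> with equal weights the variance is \<open>1\<close>, and both lie in the unit disc
  around \<open>0\<close>.
\<close>
lemma gruss_constant_ge_1:
  fixes c :: real
  assumes bound: "\<forall>(A :: complex cstar) (X :: (complex, complex) ip_module) (n :: nat) (p :: nat \<Rightarrow> real) a b x y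
          (r :: real) (s :: real).
        semi_inner_product_module A X \<and> 1 \<le> n \<and> probability_vector n p \<and>
        a \<in> carrier X \<and> b \<in> carrier X \<and>
        x \<in> {1..n} \<rightarrow> carrier X \<and> y \<in> {1..n} \<rightarrow> carrier X \<and> 0 \<le> r \<and> 0 \<le> s \<and>
        (\<forall>i\<in>{1..n}. xnorm A X (x i \<ominus>\<^bsub>X\<^esub> a) \<le> r \<and> xnorm A X (y i \<ominus>\<^bsub>X\<^esub> b) \<le> s)
      \<longrightarrow>
        cnorm A ((\<Oplus>\<^bsub>A\<^esub>i\<in>{1..n}. of_real (p i) \<odot>\<^bsub>A\<^esub> ip X (x i) (y i)) \<ominus>\<^bsub>A\<^esub>
          ip X (\<Oplus>\<^bsub>X\<^esub>i\<in>{1..n}. of_real (p i) \<odot>\<^bsub>X\<^esub> x i) (\<Oplus>\<^bsub>X\<^esub>i\<in>{1..n}. of_real (p i) \<odot>\<^bsub>X\<^esub> y i))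
        \<le> c * (r * s)"
  shows "1 \<le> c"
proof -
  let ?A = complex_cstar and ?X = complex_ip_module
  define p :: "nat \<Rightarrow> real" where "p = (\<lambda>_. 1/2)"
  define x :: "nat \<Rightarrow> complex" where "x i = (if i = 1 then 1 else - 1)" for i
  have two: "{1..2::nat} = {1, 2}" by auto
  interpret semi_inner_product_module ?A ?X by (rule complex_semi_inner_product_module)
  have minus: "a_minus ?A u v = u - v" "a_minus ?X u v = u - v" for u v
    by (rule complex_additive_group; simp add: complex_cstar_def complex_ip_module_def)+
  have ops: "carrier ?A = UNIV" "zero ?A = 0" "add ?A = (+)"
    "carrier ?X = UNIV" "zero ?X = 0" "add ?X = (+)"
    by (simp_all add: complex_cstar_def complex_ip_module_def)
  have norm: "xnorm ?A ?X z = cmod z" for z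
    by (simp add: xnorm_def complex_cstar_def complex_ip_module_def norm_mult)
  have sums: "(\<Oplus>\<^bsub>?A\<^esub>i\<in>{1..2::nat}. f i) = f 1 + f 2" "(\<Oplus>\<^bsub>?X\<^esub>i\<in>{1..2::nat}. f i) = f 1 + f 2" for f
    unfolding two by (simp_all add: ops)
  have "cnorm ?A ((\<Oplus>\<^bsub>?A\<^esub>i\<in>{1..2}. of_real (p i) \<odot>\<^bsub>?A\<^esub> ip ?X (x i) (x i)) \<ominus>\<^bsub>?A\<^esub>
          ip ?X (\<Oplus>\<^bsub>?X\<^esub>i\<in>{1..2}. of_real (p i) \<odot>\<^bsub>?X\<^esub> x i) (\<Oplus>\<^bsub>?X\<^esub>i\<in>{1..2}. of_real (p i) \<odot>\<^bsub>?X\<^esub> x i))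
        \<le> c * (1 * 1)"
    by (rule bound[rule_format, where a = 0 and b = 0])
      (auto simp: complex_semi_inner_product_module probability_vector_def p_def x_def norm minus ops)
  then show ?thesis
    unfolding sums minus by (simp add: p_def x_def complex_cstar_def complex_ip_module_def)
qed

theorem corollary1:
  shows
    "(\<forall>(A :: 'a cstar) (X :: ('a, 'x) ip_module) (n :: nat) (p :: nat \<Rightarrow> real) a b x y (r :: real) (s :: real).
        semi_inner_product_module A X \<and> probability_vector n p \<and>
        a \<in> carrier X \<and> b \<in> carrier X \<and>
        x \<in> {1..n} \<rightarrow> carrier X \<and> y \<in> {1..n} \<rightarrow> carrier X \<and> 0 \<le> r \<and> 0 \<le> s \<and>
        (\<forall>i\<in>{1..n}. xnorm A X (x i \<ominus>\<^bsub>X\<^esub> a) \<le> r \<and> xnorm A X (y i \<ominus>\<^bsub>X\<^esub> b) \<le> s)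
      \<longrightarrow>
        cnorm A ((\<Oplus>\<^bsub>A\<^esub>i\<in>{1..n}. of_real (p i) \<odot>\<^bsub>A\<^esub> ip X (x i) (y i)) \<ominus>\<^bsub>A\<^esub>
          ip X (\<Oplus>\<^bsub>X\<^esub>i\<in>{1..n}. of_real (p i) \<odot>\<^bsub>X\<^esub> x i) (\<Oplus>\<^bsub>X\<^esub>i\<in>{1..n}. of_real (p i) \<odot>\<^bsub>X\<^esub> y i))
        \<le> r * s)
     \<and>
     \<not> (\<exists>c<1. \<forall>(A :: complex cstar) (X :: (complex, complex) ip_module) (n :: nat) (p :: nat \<Rightarrow> real) a b x y
          (r :: real) (s :: real).
        semi_inner_product_module A X \<and> 1 \<le> n \<and> probability_vector n p \<and>
        a \<in> carrier X \<and> b \<in> carrier X \<and>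
        x \<in> {1..n} \<rightarrow> carrier X \<and> y \<in> {1..n} \<rightarrow> carrier X \<and> 0 \<le> r \<and> 0 \<le> s \<and>
        (\<forall>i\<in>{1..n}. xnorm A X (x i \<ominus>\<^bsub>X\<^esub> a) \<le> r \<and> xnorm A X (y i \<ominus>\<^bsub>X\<^esub> b) \<le> s)
      \<longrightarrow>
        cnorm A ((\<Oplus>\<^bsub>A\<^esub>i\<in>{1..n}. of_real (p i) \<odot>\<^bsub>A\<^esub> ip X (x i) (y i)) \<ominus>\<^bsub>A\<^esub>
          ip X (\<Oplus>\<^bsub>X\<^esub>i\<in>{1..n}. of_real (p i) \<odot>\<^bsub>X\<^esub> x i) (\<Oplus>\<^bsub>X\<^esub>i\<in>{1..n}. of_real (p i) \<odot>\<^bsub>X\<^esub> y i))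
        \<le> c * (r * s))"
proof (rule conjI, goal_cases)
  case 1
  show ?case using gruss_bound unfolding gruss_bound_def by blast
next
  case 2
  show ?case using gruss_constant_ge_1 by (force simp only: not_less[symmetric])
qed

end
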